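(* Let $n\ge2$, let $E\subset\mathbb{R}^n$ be a measurable set such that $|E\cap\Omega|<+\infty$, and let $K:\mathbb{R}^n\to(0,+\infty)$ be a positive measurable kernel such that: $K(x_1,Rx')=K(x_1,x')$ for all $(x_1,x')\in\mathbb{R}\times\mathbb{R}^{n-1}$ and all $R\in\mathrm{O}(n-1)$; for every $x_1\in\mathbb{R}$, $x'\mapsto K(x_1,x')$ is a (strictly) decreasing function of $|x'|\in(0,+\infty)$; and $K(x_1,\cdot)\in L^1(\mathbb{R}^{n-1})$ for all $x_1\in\mathbb{R}\setminus\{0\}$. Then $\mathcal{P}_K[E^{*\mathrm{cyl}}]\le\mathcal{P}_K[E]$. Moreover, if $|E\cap\Omega|>0$ and $\mathcal{P}_K[E]<+\infty$, then equality $\mathcal{P}_K[E^{*\mathrm{cyl}}]=\mathcal{P}_K[E]$ holds if, and only if, $E=E^{*\mathrm{cyl}}+(0,c)$ for some $c\in\mathbb{R}^{n-1}$, up to a set of measure $0$.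
   Context: Points of $\mathbb{R}^n$ are written $x=(x_1,x')\in\mathbb{R}\times\mathbb{R}^{n-1}$. $\Omega=\{x\in\mathbb{R}^n:-\pi<x_1<\pi\}$, $|\cdot|$ of a set is Lebesgue measure, $E^c$ is the complement of $E$. The set $E$ is not assumed to be periodic. The periodic anisotropic nonlocal perimeter is $\mathcal{P}_K[E]=\int_{E\cap\Omega}\int_{E^c}K(x-y)\,dy\,dx\in[0,+\infty]$ ($x\in E\cap\Omega$, $y\in E^c$). For $x_1\in\mathbb{R}$, $E_{x_1}=\{x'\in\mathbb{R}^{n-1}:(x_1,x')\in E\}$. The cylindrical rearrangement $E^{*\mathrm{cyl}}$ is the set such that for every $x_1\in\mathbb{R}$ the section $(E^{*\mathrm{cyl}})_{x_1}$ is the open ball of $\mathbb{R}^{n-1}$ centered at $0$ with the same $(n-1)$-dimensional Lebesgue measure as $E_{x_1}$ (and $(E^{*\mathrm{cyl}})_{x_1}=\mathbb{R}^{n-1}$ if $|E_{x_1}|=+\infty$). *)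

theory Defs
  imports "HOL-Analysis.Analysis"
begin

text \<open>
  The space \<open>\<real>\<^sup>n = \<real> \<times> \<real>\<^sup>n\<^sup>-\<^sup>1\<close> is the type \<open>real \<times> (real^'m)\<close> with \<open>CARD('m) = n - 1\<close>. Index types are
  nonempty, so the type variable \<open>'m\<close> ranges over exactly the dimensions \<open>n \<ge> 2\<close>.
\<close>

definition slab :: "(real \<times> (real^'m)) set" where
  "slab = {x. - pi < fst x \<and> fst x < pi}"

text \<open>
  For (Lebesgue) measurable \<open>E\<close> and \<open>K\<close> both integrands below are Lebesgue measurable, so the
  nonnegative integral is the usual one, with values in \<open>[0,\<infinity>]\<close>.
\<close>

definition periodic_perimeter ::
    "((real \<times> (real^'m)) \<Rightarrow> real) \<Rightarrow> (real \<times> (real^'m)) set \<Rightarrow> ennreal" where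
  "periodic_perimeter K E =
     (\<integral>\<^sup>+ x \<in> E \<inter> slab. (\<integral>\<^sup>+ y \<in> - E. ennreal (K (x - y)) \<partial>lebesgue) \<partial>lebesgue)"

definition cyl_section :: "(real \<times> (real^'m)) set \<Rightarrow> real \<Rightarrow> (real^'m) set" where
  "cyl_section E x1 = {x'. (x1, x') \<in> E}"

text \<open>
  The radius is unique (see below), and radius \<open>0\<close> gives the empty ball.
\<close>

definition ball_rearrangement :: "(real^'m) set \<Rightarrow> (real^'m) set" where
  "ball_rearrangement A =
     (if emeasure lebesgue A = \<infinity> then UNIV
      else ball 0 (THE r. 0 \<le> r \<and> emeasure lebesgue (ball (0 :: real^'m) r) = emeasure lebesgue A))"

text \<open>
  If \<open>E\<close> is Lebesgue measurable, almost every section is measurable. On the remaining null set of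
  \<open>x1\<close> the library's convention that \<open>emeasure\<close> vanishes on non-measurable sets makes the section
  of the rearrangement empty; this affects \<open>cyl_rearrangement E\<close> only on a null set.
\<close>

definition cyl_rearrangement :: "(real \<times> (real^'m)) set \<Rightarrow> (real \<times> (real^'m)) set" where
  "cyl_rearrangement E = {(x1, x'). x' \<in> ball_rearrangement (cyl_section E x1)}"

lemma ball_radius_ex1:
  fixes A :: "(real^'m) set"
  assumes "emeasure lebesgue A \<noteq> \<infinity>"
  shows "\<exists>!r. 0 \<le> r \<and> emeasure lebesgue (ball (0 :: real^'m) r) = emeasure lebesgue A"
proof -
  let ?n = "CARD('m)"
  let ?V = "unit_ball_vol (real ?n)"
  obtain a where a: "0 \<le> a" "emeasure lebesgue A = ennreal a"
    using assms by (cases "emeasure lebesgue A") auto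
  have V: "?V > 0" by simp
  have n: "0 < ?n" by simp
  have vol: "emeasure lebesgue (ball (0 :: real^'m) r) = ennreal (?V * r ^ ?n)" if "0 \<le> r" for r
    using that by (simp add: emeasure_ball)
  have "emeasure lebesgue (ball (0 :: real^'m) r) = emeasure lebesgue A \<longleftrightarrow> r = root ?n (a / ?V)"
    if "0 \<le> r" for r
  proof -
    have "emeasure lebesgue (ball (0 :: real^'m) r) = emeasure lebesgue A \<longleftrightarrow> ?V * r ^ ?n = a"
      unfolding vol[OF that] a(2) using that a(1) V by (simp add: ennreal_inj)
    also have "\<dots> \<longleftrightarrow> r ^ ?n = a / ?V"
      using eq_divide_eq[of "r ^ ?n" a ?V] V by (metis less_irrefl mult.commute)
    also have "\<dots> \<longleftrightarrow> r = root ?n (a / ?V)"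
      using that a(1) V n by (metis divide_nonneg_pos real_root_pos2 real_root_pow_pos2)
    finally show ?thesis .
  qed
  moreover have "0 \<le> root ?n (a / ?V)"
    using a(1) V by (simp add: real_root_ge_zero)
  ultimately show ?thesis by blast
qed

end

theory Submission
  imports Defs
begin

text \<open>
  For two slices at heights \<open>x\<^sub>1 \<noteq> y\<^sub>1\<close> the claim is Riesz' rearrangement inequality
  \<open>\<integral>\<integral> 1\<^sub>A(x) 1\<^sub>B(y) k(x - y) \<le> \<integral>\<integral> 1\<^bsub>A*\<^esub>(x) 1\<^bsub>B*\<^esub>(y) k(x - y)\<close> for a strictly decreasing radial kernel, together with its equality
  case. It is obtained by polarization, i.e. by exchanging mass between a point and its mirror image in a
  hyperplane: this never decreases the interaction of \<open>A\<close> and \<open>B\<close>. If \<open>A\<close> is not the centred ball, then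
  averaging over all hyperplanes produces one whose polarization increases \<open>|A \<inter> A*|\<close> by an amount depending
  only on \<open>|A - A*|\<close>; hence among the pairs with at least the original interaction there are pairs arbitrarily
  close to \<open>(A*, B*)\<close>.

  In the equality case every polarization preserves the interaction, so \<open>A\<close> and \<open>B\<close> never prefer
  opposite sides of a hyperplane. Choosing for \<open>B\<close> a centre that lies on the heavier side of every hyperplane with
  respect to which \<open>B\<close> is polarized, one sees that \<open>A\<close> is polarized towards the centre of \<open>B\<close> and is thus a ball
  around it, and vice versa. Since almost all pairs of slices are tested against each other, all
  slices of \<open>E\<close> share one centre.
\<close>

text \<open>The perimeter couples a slice \<open>A\<close> with the complement of another slice
  \<open>B\<close>, and that complement may have infinite measure, whereas Riesz' inequality
  concerns two sets of finite measure. The bridge is integrability of the kernel: the interactions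
  of \<open>A\<close> with \<open>B\<close> and with \<open>- B\<close> add up to |A| times the
  integral of \<open>k\<close>, a total that rearrangement preserves. More interaction with
  \<open>B\<close> therefore means less with its complement. This needs different heights, where
  integrability is assumed, and finite |A|, which holds for almost every slice in the slab. The
  slice \<open>B\<close> ranges over all heights and may be infinite; then its rearrangement has
  empty complement. The gain obtained by averaging is uniform over all sets in a fixed ball. A
  near-maximizer of the overlap with the balls thus replaces a convergent sequence of polarizations.
  Strict inequalities would not survive a limit, so the equality case compares the original pair
  with a single polarization of it and applies the inequality already proved to the polarized
  pair.\<close>

section \<open>Reflections in hyperplanes\<close>

text \<open>The normal \<open>v\<close> is not normalized, so that the reflections are parametrized
  by a Euclidean space and can be averaged with Lebesgue measure. For \<open>v = 0\<close> the map
  is the identity.\<close>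

definition hreflect :: "'a::real_inner \<Rightarrow> real \<Rightarrow> 'a \<Rightarrow> 'a" where
  "hreflect v t x = x - (2 * (x \<bullet> v - t) / (v \<bullet> v)) *\<^sub>R v"

lemma hreflect_inner: "v \<noteq> 0 \<Longrightarrow> hreflect v t x \<bullet> v = 2 * t - x \<bullet> v"
  by (simp add: hreflect_def inner_diff_left)

lemma hreflect_hreflect [simp]: "hreflect v t (hreflect v t x) = x"
proof (cases "v = 0")
  case False
  have "2 * (hreflect v t x \<bullet> v - t) / (v \<bullet> v) = - (2 * (x \<bullet> v - t) / (v \<bullet> v))"
    by (simp add: hreflect_inner[OF False] minus_divide_left)
  then show ?thesis
    unfolding hreflect_def[of v t "hreflect v t x"] by (simp only:) (simp add: hreflect_def)
qed (simp add: hreflect_def)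

lemma hreflect_uminus: "hreflect (- v) (- t) x = hreflect v t x"
proof -
  have "2 * (x \<bullet> - v - - t) / (- v \<bullet> - v) = - (2 * (x \<bullet> v - t) / (v \<bullet> v))"
    by (simp add: minus_divide_left)
  then show ?thesis unfolding hreflect_def by (simp only:) simp
qed

text \<open>All comparisons of distances rest on the sign of the last term: if \<open>x\<close> and
  \<open>y\<close> lie on the same side of the hyperplane, then \<open>x\<close> is closer to
  \<open>y\<close> than its mirror image is, and on opposite sides it is the other way
  round.\<close>

lemma norm_hreflect_diff_sq:
  assumes "v \<noteq> 0"
  shows "(norm (y - hreflect v t x))\<^sup>2 = (norm (y - x))\<^sup>2 + 4 * (x \<bullet> v - t) * (y \<bullet> v - t) / (v \<bullet> v)"
proof -
  let ?c = "2 * (x \<bullet> v - t) / (v \<bullet> v)"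
  have v: "v \<bullet> v \<noteq> 0" using assms by simp
  have "y - hreflect v t x = (y - x) + ?c *\<^sub>R v" by (simp add: hreflect_def)
  moreover have "(norm (w + c *\<^sub>R v))\<^sup>2 = (norm w)\<^sup>2 + 2 * c * (w \<bullet> v) + c * (c * (v \<bullet> v))" for w c
    by (simp add: power2_norm_eq_inner inner_add_left inner_add_right inner_commute[of v w] distrib_left)
  ultimately have "(norm (y - hreflect v t x))\<^sup>2
      = (norm (y - x))\<^sup>2 + (2 * ?c * (y \<bullet> v - x \<bullet> v) + ?c * (?c * (v \<bullet> v)))"
    by (simp only: inner_diff_left add.assoc)
  also have "?c * (v \<bullet> v) = 2 * (x \<bullet> v - t)" using v by simp
  also have "2 * ?c * (y \<bullet> v - x \<bullet> v) + ?c * (2 * (x \<bullet> v - t)) = 2 * ?c * (y \<bullet> v - t)"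
    by (simp only: ring_distribs)
  finally show ?thesis by (simp add: ac_simps)
qed

lemma norm_hreflect_hreflect: "norm (hreflect v t x - hreflect v t y) = norm (x - y)"
proof (cases "v = 0")
  case False
  have "(norm (hreflect v t x - hreflect v t y))\<^sup>2 = (norm (x - y))\<^sup>2"
  proof -
    have "(norm (hreflect v t x - hreflect v t y))\<^sup>2 = (norm (hreflect v t x - y))\<^sup>2
        + 4 * (y \<bullet> v - t) * (hreflect v t x \<bullet> v - t) / (v \<bullet> v)"
      by (rule norm_hreflect_diff_sq[OF False])
    also have "(norm (hreflect v t x - y))\<^sup>2 = (norm (x - y))\<^sup>2 + 4 * (x \<bullet> v - t) * (y \<bullet> v - t) / (v \<bullet> v)"
      using norm_hreflect_diff_sq[OF False, of y t x] by (simp add: norm_minus_commute)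
    also have "4 * (y \<bullet> v - t) * (hreflect v t x \<bullet> v - t) / (v \<bullet> v)
        = - (4 * (x \<bullet> v - t) * (y \<bullet> v - t) / (v \<bullet> v))"
      unfolding hreflect_inner[OF False] minus_divide_left by (simp add: algebra_simps)
    finally show ?thesis by simp
  qed
  then show ?thesis by simp
qed (simp add: hreflect_def)

lemma norm_diff_hreflect: "norm (x - hreflect v t y) = norm (hreflect v t x - y)"
  by (metis hreflect_hreflect norm_hreflect_hreflect)

lemma norm_le_hreflect:
  assumes "v \<noteq> 0" "(x \<bullet> v - t) * (y \<bullet> v - t) \<ge> 0"
  shows "norm (y - x) \<le> norm (y - hreflect v t x)"
proof -
  have "4 * (x \<bullet> v - t) * (y \<bullet> v - t) / (v \<bullet> v) \<ge> 0"
    using assms(2) by (intro divide_nonneg_nonneg) (simp_all only: mult.assoc, simp_all)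
  then have "(norm (y - x))\<^sup>2 \<le> (norm (y - hreflect v t x))\<^sup>2"
    by (simp add: norm_hreflect_diff_sq[OF assms(1)])
  then show ?thesis by (simp add: power2_le_iff_abs_le)
qed

lemma norm_ge_hreflect:
  assumes "v \<noteq> 0" "(x \<bullet> v - t) * (y \<bullet> v - t) \<le> 0"
  shows "norm (y - hreflect v t x) \<le> norm (y - x)"
  using norm_le_hreflect[OF assms(1), of "hreflect v t x" t y] assms
  by (simp add: hreflect_inner algebra_simps)

lemma norm_less_hreflect_iff:
  assumes "v \<noteq> 0"
  shows "norm (y - x) < norm (y - hreflect v t x) \<longleftrightarrow> (x \<bullet> v - t) * (y \<bullet> v - t) > 0"
proof -
  have "norm (y - x) < norm (y - hreflect v t x) \<longleftrightarrow> (norm (y - x))\<^sup>2 < (norm (y - hreflect v t x))\<^sup>2"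
    using power2_less_imp_less[of "norm (y - x)"] power_strict_mono[of "norm (y - x)" _ 2] by auto
  also have "\<dots> \<longleftrightarrow> (x \<bullet> v - t) * (y \<bullet> v - t) > 0"
  proof -
    have "0 < 4 * (x \<bullet> v - t) * (y \<bullet> v - t) / (v \<bullet> v) \<longleftrightarrow> 0 < 4 * ((x \<bullet> v - t) * (y \<bullet> v - t))"
    proof -
      have "v \<bullet> v > 0" using assms by simp
      then show ?thesis by (simp only: zero_less_divide_iff mult.assoc) (meson less_asym)
    qed
    then show ?thesis by (simp add: norm_hreflect_diff_sq[OF assms])
  qed
  finally show ?thesis .
qed

lemma borel_measurable_hreflect [measurable (raw)]:
  fixes v x :: "'b \<Rightarrow> 'a::euclidean_space"
  assumes [measurable]: "v \<in> borel_measurable M" "t \<in> borel_measurable M" "x \<in> borel_measurable M"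
  shows "(\<lambda>z. hreflect (v z) (t z) (x z)) \<in> borel_measurable M"
  unfolding hreflect_def by measurable

lemma vimage_hreflect_borel [measurable]:
  assumes [measurable]: "S \<in> sets borel"
  shows "hreflect (v :: 'a::euclidean_space) t -` S \<in> sets borel"
  using measurable_sets[of "hreflect v t" borel borel S] by simp

section \<open>Invariance of Lebesgue measure under translations, dilations and reflections\<close>

lemma nn_integral_lborel_affine:
  fixes t :: "'a::euclidean_space"
  assumes [measurable]: "f \<in> borel_measurable borel" and c: "c \<noteq> 0"
  shows "ennreal (\<bar>c\<bar> ^ DIM('a)) * (\<integral>\<^sup>+x. f (t + c *\<^sub>R x) \<partial>lborel) = (\<integral>\<^sup>+x. f x \<partial>lborel)"
  by (subst (2) lborel_affine[OF c, of t])
    (simp add: nn_integral_density nn_integral_distr nn_integral_cmult)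

lemma nn_integral_lborel_shift:
  fixes t :: "'a::euclidean_space"
  assumes "f \<in> borel_measurable borel"
  shows "(\<integral>\<^sup>+x. f (x + t) \<partial>lborel) = (\<integral>\<^sup>+x. f x \<partial>lborel)"
  using nn_integral_lborel_affine[OF assms, of 1 t] by (simp add: add.commute)

lemma nn_integral_lborel_reflect:
  fixes t :: "'a::euclidean_space"
  assumes "f \<in> borel_measurable borel"
  shows "(\<integral>\<^sup>+x. f (t - x) \<partial>lborel) = (\<integral>\<^sup>+x. f x \<partial>lborel)"
  using nn_integral_lborel_affine[OF assms, of "-1" t] by simp

lemma linear_hreflect_0: "linear (hreflect v 0)"
proof (rule linearI)
  show "hreflect v 0 (x + y) = hreflect v 0 x + hreflect v 0 y" for x y
    by (simp add: hreflect_def inner_add_left distrib_left add_divide_distrib scaleR_left_distrib)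
  show "hreflect v 0 (c *\<^sub>R x) = c *\<^sub>R hreflect v 0 x" for c x
    by (simp add: hreflect_def scaleR_right_diff_distrib mult.left_commute)
qed

lemma norm_hreflect_0 [simp]: "norm (hreflect v 0 x) = norm x"
  using norm_hreflect_hreflect[of v 0 x 0] by (simp add: hreflect_def)

text \<open>
  The uniqueness argument for Haar measure: for the linear involution \<open>f\<close>, unfolding
  \<open>\<integral>\<integral> 1\<^sub>A(x) 1\<^sub>B(f z) dx dz\<close> with the help of translations shows that \<open>|f A| / |A|\<close> is the same for all \<open>A\<close>,
  and for \<open>A\<close> a centred ball this ratio is \<open>1\<close>.
\<close>

lemma emeasure_vimage_hreflect_0:
  fixes v :: "'a::euclidean_space"
  assumes A [measurable]: "A \<in> sets borel"
  shows "emeasure lborel (hreflect v 0 -` A) = emeasure lborel A"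
proof -
  let ?f = "hreflect v 0"
  define B where "B = ball (0 :: 'a) 1"
  have [measurable]: "B \<in> sets borel" by (simp add: B_def)
  have B: "emeasure lborel B \<noteq> 0" "emeasure lborel B \<noteq> \<infinity>"
    using emeasure_ball[of 1 "0::'a"]
    by (simp_all add: B_def unit_ball_vol_pos less_imp_neq[symmetric] emeasure_lborel_ball_finite less_imp_neq)
  have ind: "(\<integral>\<^sup>+z. indicator S (?f z) \<partial>lborel) = emeasure lborel (?f -` S)" if "S \<in> sets borel" for S
  proof -
    have "(\<integral>\<^sup>+z. indicator S (?f z) \<partial>lborel) = (\<integral>\<^sup>+z. indicator (?f -` S) z \<partial>lborel)"
      by (intro nn_integral_cong) (simp add: indicator_def)
    then show ?thesis using that by simp
  qed
  have add: "?f (x + y) = ?f x + ?f y" for x y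
    by (simp add: linear_hreflect_0 linear_add)
  have neg: "?f (- x) = - ?f x" for x
    by (simp add: linear_hreflect_0 linear_neg)
  have "emeasure lborel A * emeasure lborel B = emeasure lborel A * emeasure lborel (?f -` B)"
    by (simp add: B_def vimage_def ball_def dist_norm)
  also have "\<dots> = (\<integral>\<^sup>+x. \<integral>\<^sup>+z. indicator A x * indicator B (?f z) \<partial>lborel \<partial>lborel)"
    by (simp add: nn_integral_cmult nn_integral_multc ind del: indicator_simps)
  \<comment> \<open>Translating \<open>z\<close> by \<open>?f x\<close> turns \<open>?f z\<close>
    into \<open>?f z + x\<close>, because \<open>?f\<close> is additive and an involution.\<close>
  also have "\<dots> = (\<integral>\<^sup>+x. \<integral>\<^sup>+z. indicator A x * indicator B (?f z + x) \<partial>lborel \<partial>lborel)"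
  proof (rule nn_integral_cong)
    fix x
    show "(\<integral>\<^sup>+z. indicator A x * indicator B (?f z) \<partial>lborel)
        = (\<integral>\<^sup>+z. indicator A x * indicator B (?f z + x) \<partial>lborel)"
      using nn_integral_lborel_shift[of "\<lambda>z. indicator A x * indicator B (?f z)" "?f x"]
      by (simp add: add)
  qed
  also have "\<dots> = (\<integral>\<^sup>+z. \<integral>\<^sup>+x. indicator A x * indicator B (?f z + x) \<partial>lborel \<partial>lborel)"
    by (rule lborel_pair.Fubini') simp
  also have "\<dots> = (\<integral>\<^sup>+z. \<integral>\<^sup>+x. indicator A (x - ?f z) * indicator B x \<partial>lborel \<partial>lborel)"
  proof (rule nn_integral_cong)
    fix z
    show "(\<integral>\<^sup>+x. indicator A x * indicator B (?f z + x) \<partial>lborel)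
        = (\<integral>\<^sup>+x. indicator A (x - ?f z) * indicator B x \<partial>lborel)"
      using nn_integral_lborel_shift[of "\<lambda>x. indicator A (x - ?f z) * indicator B x" "?f z"]
      by (simp add: add.commute)
  qed
  also have "\<dots> = (\<integral>\<^sup>+x. \<integral>\<^sup>+z. indicator A (x - ?f z) * indicator B x \<partial>lborel \<partial>lborel)"
    by (rule lborel_pair.Fubini') simp
  also have "\<dots> = (\<integral>\<^sup>+x. emeasure lborel (?f -` A) * indicator B x \<partial>lborel)"
  proof (rule nn_integral_cong)
    fix x
    have "(\<integral>\<^sup>+z. indicator A (x - ?f z) * indicator B x \<partial>lborel)
        = (\<integral>\<^sup>+z. indicator A (?f (?f x - z)) \<partial>lborel) * indicator B x"
      by (simp add: nn_integral_multc add neg flip: add_uminus_conv_diff)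
    also have "\<dots> = (\<integral>\<^sup>+z. indicator A (?f z) \<partial>lborel) * indicator B x"
      using nn_integral_lborel_reflect[of "\<lambda>z. indicator A (?f z)" "?f x"] by simp
    finally show "(\<integral>\<^sup>+z. indicator A (x - ?f z) * indicator B x \<partial>lborel)
        = emeasure lborel (?f -` A) * indicator B x"
      by (simp add: ind)
  qed
  also have "\<dots> = emeasure lborel (?f -` A) * emeasure lborel B"
    by (simp add: nn_integral_cmult)
  finally have "emeasure lborel A * emeasure lborel B = emeasure lborel (?f -` A) * emeasure lborel B" .
  then show ?thesis using B by (metis mult_divide_eq_ennreal infinity_ennreal_def)
qed

lemma distr_lborel_hreflect:
  fixes v :: "'a::euclidean_space"
  shows "distr lborel borel (hreflect v t) = lborel"
proof (rule measure_eqI)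
  fix A :: "'a set" assume "A \<in> sets (distr lborel borel (hreflect v t))"
  then have [measurable]: "A \<in> sets borel" by simp
  define a where "a = (2 * t / (v \<bullet> v)) *\<^sub>R v"
  have eq: "hreflect v t x = a + hreflect v 0 x" for x
    by (simp add: hreflect_def a_def diff_divide_distrib right_diff_distrib scaleR_left_diff_distrib)
  have "(+) a -` A \<in> sets borel"
    using measurable_sets[of "(+) a" borel borel A] by simp
  then have "emeasure lborel (hreflect v 0 -` (+) a -` A) = emeasure lborel ((+) a -` A)"
    by (rule emeasure_vimage_hreflect_0)
  also have "\<dots> = emeasure (distr lborel borel ((+) a)) A"
    by (simp add: emeasure_distr)
  finally show "emeasure (distr lborel borel (hreflect v t)) A = emeasure lborel A"
    by (simp add: lborel_distr_plus emeasure_distr vimage_def eq)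
qed simp

lemma nn_integral_hreflect:
  fixes v :: "'a::euclidean_space"
  assumes [measurable]: "f \<in> borel_measurable borel"
  shows "(\<integral>\<^sup>+x. f (hreflect v t x) \<partial>lborel) = (\<integral>\<^sup>+x. f x \<partial>lborel)"
  by (subst (2) distr_lborel_hreflect[of v t, symmetric]) (simp add: nn_integral_distr)

section \<open>Polarization\<close>

text \<open>This transfers equality of energies to equality of integrands. It is applied twice in a
  row to iterated integrals: to the inner integrals first, and then to the integrands
  inside.\<close>

lemma nn_integral_eq_imp_AE_eq:
  assumes [measurable]: "f \<in> borel_measurable M" "g \<in> borel_measurable M"
    and le: "AE x in M. f x \<le> (g x :: ennreal)"
    and eq: "(\<integral>\<^sup>+x. f x \<partial>M) = (\<integral>\<^sup>+x. g x \<partial>M)" and fin: "(\<integral>\<^sup>+x. g x \<partial>M) \<noteq> \<infinity>"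
  shows "AE x in M. f x = g x"
proof -
  have "(\<integral>\<^sup>+x. g x - f x \<partial>M) = (\<integral>\<^sup>+x. g x \<partial>M) - (\<integral>\<^sup>+x. f x \<partial>M)"
    using fin le by (intro nn_integral_diff) (auto simp: eq)
  also have "\<dots> = 0" using fin by (simp add: eq)
  finally have "AE x in M. g x - f x = 0"
    by (subst (asm) nn_integral_0_iff_AE) auto
  with le show ?thesis
  proof eventually_elim
    case (elim x)
    then show ?case by (cases "f x = \<infinity>") (auto simp: ennreal_minus_eq_0 top_unique intro: antisym)
  qed
qed

lemma AE_positive_measure_ex:
  assumes "AE x in M. P x" "emeasure M S \<noteq> 0" "S \<in> sets M"
  shows "\<exists>x\<in>S. P x"
proof (rule ccontr)
  assume no: "\<not> (\<exists>x\<in>S. P x)"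
  have "AE x in M. x \<notin> S"
    using assms(1) by eventually_elim (use no in auto)
  then have "S \<in> null_sets M"
    using assms(3) by (simp add: AE_iff_null_sets)
  with assms(2) show False by auto
qed

lemma emeasure_Diff_eq:
  assumes [measurable]: "A \<in> sets M" "B \<in> sets M" and eq: "emeasure M A = emeasure M B" "emeasure M A \<noteq> \<infinity>"
  shows "emeasure M (A - B) = emeasure M (B - A)"
proof -
  have fin: "emeasure M (A \<inter> B) \<noteq> \<infinity>"
    using emeasure_mono[of "A \<inter> B" A M] eq(2) by (auto simp: top_unique)
  have "emeasure M (A \<inter> B) + emeasure M (A - B) = emeasure M A"
    by (subst plus_emeasure) (auto intro!: arg_cong[where f="emeasure M"])
  moreover have "emeasure M (A \<inter> B) + emeasure M (B - A) = emeasure M B"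
    by (subst plus_emeasure) (auto intro!: arg_cong[where f="emeasure M"])
  ultimately show ?thesis
    using eq fin by (metis ennreal_add_left_cancel)
qed

lemma emeasure_SUP_Int_ball:
  fixes S :: "'a::euclidean_space set"
  assumes [measurable]: "S \<in> sets borel"
  shows "emeasure lborel S = (SUP n. emeasure lborel (S \<inter> ball 0 (real n)))"
proof (subst SUP_emeasure_incseq)
  show "incseq (\<lambda>n. S \<inter> ball 0 (real n))" by (auto simp: incseq_def)
  have "\<exists>n. norm x < real n" for x :: 'a by (rule reals_Archimedean2)
  then have "(\<Union>n. S \<inter> ball 0 (real n)) = S" by auto
  then show "emeasure lborel S = emeasure lborel (\<Union>n. S \<inter> ball 0 (real n))" by simp
qed auto

text \<open>The favoured side is \<open>x \<bullet> v < t\<close>: if only one of two mirror points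
  belongs to \<open>A\<close>, the polarized set contains the one on this side. Points on the
  hyperplane are their own images and keep their membership.\<close>

definition polarize :: "'a::real_inner \<Rightarrow> real \<Rightarrow> 'a set \<Rightarrow> 'a set" where
  "polarize v t A =
    {x. if x \<bullet> v < t then x \<in> A \<or> hreflect v t x \<in> A else x \<in> A \<and> hreflect v t x \<in> A}"

lemma polarize_iff:
  assumes "v \<noteq> 0"
  shows "x \<bullet> v < t \<Longrightarrow> x \<in> polarize v t A \<longleftrightarrow> x \<in> A \<or> hreflect v t x \<in> A"
    and "x \<bullet> v < t \<Longrightarrow> hreflect v t x \<in> polarize v t A \<longleftrightarrow> x \<in> A \<and> hreflect v t x \<in> A"
    and "\<not> x \<bullet> v < t \<Longrightarrow> x \<in> polarize v t A \<longleftrightarrow> x \<in> A \<and> hreflect v t x \<in> A"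
    and "\<not> x \<bullet> v < t \<Longrightarrow> hreflect v t x \<in> polarize v t A \<longleftrightarrow> x \<in> A \<or> hreflect v t x \<in> A"
proof -
  have eq: "hreflect v t x = x" if "x \<bullet> v = t" using that by (simp add: hreflect_def)
  show "x \<bullet> v < t \<Longrightarrow> x \<in> polarize v t A \<longleftrightarrow> x \<in> A \<or> hreflect v t x \<in> A"
    and "x \<bullet> v < t \<Longrightarrow> hreflect v t x \<in> polarize v t A \<longleftrightarrow> x \<in> A \<and> hreflect v t x \<in> A"
    and "\<not> x \<bullet> v < t \<Longrightarrow> x \<in> polarize v t A \<longleftrightarrow> x \<in> A \<and> hreflect v t x \<in> A"
    by (auto simp: polarize_def hreflect_inner[OF assms])
  show "\<not> x \<bullet> v < t \<Longrightarrow> hreflect v t x \<in> polarize v t A \<longleftrightarrow> x \<in> A \<or> hreflect v t x \<in> A"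
    using eq by (cases "x \<bullet> v = t") (auto simp: polarize_def hreflect_inner[OF assms])
qed

lemma sets_borel_polarize [measurable]:
  fixes A :: "'a::euclidean_space set"
  assumes [measurable]: "A \<in> sets borel"
  shows "polarize v t A \<in> sets borel"
  unfolding polarize_def by measurable

lemma nn_integral_add_hreflect:
  fixes v :: "'a::euclidean_space"
  assumes [measurable]: "f \<in> borel_measurable borel"
  shows "(\<integral>\<^sup>+x. f x + f (hreflect v t x) \<partial>lborel) = 2 * (\<integral>\<^sup>+x. f x \<partial>lborel)"
  by (simp add: nn_integral_add nn_integral_hreflect mult_2)

text \<open>Within a pair of mirror points polarization at most exchanges memberships, so the sum of
  the two indicator values is unchanged. Integrating this sum counts every set twice.\<close>

lemma emeasure_polarize:
  fixes A :: "'a::euclidean_space set"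
  assumes [measurable]: "A \<in> sets borel" and "v \<noteq> 0"
  shows "emeasure lborel (polarize v t A) = emeasure lborel A"
proof -
  let ?A = "polarize v t A"
  have "2 * (\<integral>\<^sup>+x. indicator ?A x \<partial>lborel) = (\<integral>\<^sup>+x. indicator ?A x + indicator ?A (hreflect v t x) \<partial>lborel)"
    by (rule nn_integral_add_hreflect[symmetric]) simp
  also have "\<dots> = (\<integral>\<^sup>+x. indicator A x + indicator A (hreflect v t x) \<partial>lborel)"
  proof (rule nn_integral_cong)
    fix x show "(indicator ?A x :: ennreal) + indicator ?A (hreflect v t x) = indicator A x + indicator A (hreflect v t x)"
      using polarize_iff[OF assms(2), of x t A] by (cases "x \<bullet> v < t") (auto simp: indicator_def)
  qed
  also have "\<dots> = 2 * (\<integral>\<^sup>+x. indicator A x \<partial>lborel)"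
    by (rule nn_integral_add_hreflect) simp
  finally show ?thesis by (simp add: ennreal_mult_cancel_left)
qed

section \<open>The Riesz functional and its growth under polarization\<close>

definition interaction :: "('a::euclidean_space \<Rightarrow> ennreal) \<Rightarrow> 'a set \<Rightarrow> 'a set \<Rightarrow> ennreal" where
  "interaction k A B = (\<integral>\<^sup>+x. \<integral>\<^sup>+y. indicator A x * indicator B y * k (x - y) \<partial>lborel \<partial>lborel)"

text \<open>Strict decrease includes the origin, where the kernel may take the value \<infinity>. It
  also makes the kernel finite away from the origin and positive everywhere.\<close>

locale radial_kernel =
  fixes k :: "'a::euclidean_space \<Rightarrow> ennreal"
  assumes decr: "norm x < norm y \<Longrightarrow> k y < k x"
    and radial: "norm x = norm y \<Longrightarrow> k x = k y"
    and integral_finite: "(\<integral>\<^sup>+x. k x \<partial>lborel) \<noteq> \<infinity>"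
begin

lemma k_antimono: "norm x \<le> norm y \<Longrightarrow> k y \<le> k x"
  using decr radial by (metis le_less order_refl)

text \<open>Superlevel sets contain with a point all points of smaller or equal norm. Such a set is
  empty, the whole space, or an open or closed centred ball, according to whether the supremum of
  the norms is attained.\<close>

lemma measurable_k [measurable]: "k \<in> borel_measurable borel"
proof (rule borel_measurableI_greater)
  fix a
  let ?S = "{x. a < k x}"
  have down: "x \<in> ?S" if "norm x \<le> norm y" "y \<in> ?S" for x y
    using k_antimono[OF that(1)] that(2) by auto
  have "?S \<in> sets borel"
  proof (cases "bdd_above (norm ` ?S) \<and> ?S \<noteq> {}")
    case True
    define r where "r = Sup (norm ` ?S)"
    have le: "norm x \<le> r" if "x \<in> ?S" for x
      unfolding r_def using True that by (intro cSup_upper) auto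
    have less: "x \<in> ?S" if "norm x < r" for x
    proof -
      have "\<exists>z\<in>norm ` ?S. norm x < z"
        using that True unfolding r_def by (subst (asm) less_cSup_iff) auto
      then obtain y where "y \<in> ?S" "norm x < norm y" by blast
      then show ?thesis by (intro down[of x y]) auto
    qed
    have "?S = ball 0 r \<or> ?S = cball 0 r"
    proof (cases "\<exists>x\<in>?S. norm x = r")
      case True
      then obtain x where "x \<in> ?S" "norm x = r" by blast
      have "?S = cball 0 r"
      proof (rule set_eqI)
        fix y show "y \<in> ?S \<longleftrightarrow> y \<in> cball 0 r"
          using le[of y] down[of y x] \<open>x \<in> ?S\<close> \<open>norm x = r\<close> by (metis mem_cball_0)
      qed
      then show ?thesis ..
    next
      case False
      have "?S = ball 0 r"
      proof (rule set_eqI)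
        fix x show "x \<in> ?S \<longleftrightarrow> x \<in> ball 0 r"
          using le[of x] less[of x] False by (metis less_le mem_ball_0)
      qed
      then show ?thesis ..
    qed
    then show ?thesis by auto
  next
    case False
    have "x \<in> ?S" if "?S \<noteq> {}" for x
    proof -
      have "\<not> (\<forall>y\<in>?S. norm y \<le> norm x)"
        using False that by (auto simp: bdd_above_def)
      then obtain y where "y \<in> ?S" "norm x < norm y" by (auto simp: not_le)
      then show ?thesis by (intro down[of x y]) auto
    qed
    then have "?S = {} \<or> ?S = UNIV" by blast
    then show ?thesis by auto
  qed
  then show "{x \<in> space borel. a < k x} \<in> sets borel" by simp
qed

text \<open>Summing the integrand over independent reflections of \<open>x\<close> and \<open>y\<close> turns the polarization inequality
  into a pointwise one.\<close>

definition quad :: "'a \<Rightarrow> real \<Rightarrow> 'a set \<Rightarrow> 'a set \<Rightarrow> 'a \<Rightarrow> 'a \<Rightarrow> ennreal" where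
  "quad v t A B x y =
     (indicator A x * indicator B y + indicator A (hreflect v t x) * indicator B (hreflect v t y)) * k (x - y)
   + (indicator A x * indicator B (hreflect v t y) + indicator A (hreflect v t x) * indicator B y) * k (x - hreflect v t y)"

lemma measurable_quad [measurable]:
  assumes [measurable]: "A \<in> sets borel" "B \<in> sets borel"
  shows "(\<lambda>(x, y). quad v t A B x y) \<in> borel_measurable (borel \<Otimes>\<^sub>M borel)"
  unfolding quad_def by measurable

text \<open>Each of the four combinations of reflecting \<open>x\<close> and \<open>y\<close>
  contributes the full interaction. Only two kernel values occur, because reflecting both arguments
  preserves their distance.\<close>

lemma interaction_quad:
  assumes [measurable]: "A \<in> sets borel" "B \<in> sets borel"
  shows "(\<integral>\<^sup>+x. \<integral>\<^sup>+y. quad v t A B x y \<partial>lborel \<partial>lborel) = 4 * interaction k A B"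
proof -
  let ?r = "hreflect v t"
  define F where "F x y = indicator A x * indicator B y * k (x - y)" for x y
  have [measurable]: "(\<lambda>(x, y). F x y) \<in> borel_measurable (borel \<Otimes>\<^sub>M borel)"
    unfolding F_def by measurable
  have r: "k (?r x - ?r y) = k (x - y)" "k (?r x - y) = k (x - ?r y)" for x y
    by (auto intro!: radial simp: norm_hreflect_hreflect norm_diff_hreflect)
  have "quad v t A B x y = (F x y + F x (?r y)) + (F (?r x) y + F (?r x) (?r y))" for x y
    by (simp add: quad_def F_def r distrib_right distrib_left ac_simps)
  then have "(\<integral>\<^sup>+x. \<integral>\<^sup>+y. quad v t A B x y \<partial>lborel \<partial>lborel)
      = (\<integral>\<^sup>+x. \<integral>\<^sup>+y. (F x y + F x (?r y)) + (F (?r x) y + F (?r x) (?r y)) \<partial>lborel \<partial>lborel)"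
    by simp
  also have "\<dots> = (\<integral>\<^sup>+x. (\<integral>\<^sup>+y. F x y + F x (?r y) \<partial>lborel) + (\<integral>\<^sup>+y. F (?r x) y + F (?r x) (?r y) \<partial>lborel) \<partial>lborel)"
    by (intro nn_integral_cong nn_integral_add) measurable
  also have "\<dots> = (\<integral>\<^sup>+x. 2 * (\<integral>\<^sup>+y. F x y \<partial>lborel) + 2 * (\<integral>\<^sup>+y. F (?r x) y \<partial>lborel) \<partial>lborel)"
    by (subst (1 2) nn_integral_add_hreflect) simp_all
  also have "\<dots> = 2 * (\<integral>\<^sup>+x. 2 * (\<integral>\<^sup>+y. F x y \<partial>lborel) \<partial>lborel)"
    by (rule nn_integral_add_hreflect) simp
  also have "\<dots> = 4 * interaction k A B"
    by (simp add: nn_integral_cmult interaction_def F_def flip: mult.assoc)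
  finally show ?thesis .
qed

lemma quad_polarize:
  assumes v: "v \<noteq> 0"
  shows "quad v t A B x y \<le> quad v t (polarize v t A) (polarize v t B) x y"
proof -
  let ?r = "hreflect v t"
  define p q where "p = k (x - y)" and "q = k (x - ?r y)"
  have same: "q \<le> p" if "x \<bullet> v < t \<longleftrightarrow> y \<bullet> v < t"
    unfolding p_def q_def using that
    by (intro k_antimono norm_le_hreflect v) (auto simp: zero_le_mult_iff)
  have opp: "p \<le> q" if "x \<bullet> v < t \<longleftrightarrow> \<not> y \<bullet> v < t"
    unfolding p_def q_def using that
    by (intro k_antimono norm_ge_hreflect v) (auto simp: mult_le_0_iff)
  note A = polarize_iff[OF v, of x t A] and B = polarize_iff[OF v, of y t B]
  have pq: "q + q \<le> p + p" if "q \<le> p" using that by (intro add_mono)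
  have qp: "p + p \<le> q + q" if "p \<le> q" using that by (intro add_mono)
  show ?thesis
    unfolding quad_def p_def[symmetric] q_def[symmetric]
    apply (cases "x \<bullet> v < t"; cases "y \<bullet> v < t"; cases "x \<in> A"; cases "?r x \<in> A"; cases "y \<in> B"; cases "?r y \<in> B")
    using same opp by (simp_all add: A B add.commute add_increasing add_increasing2)
qed

text \<open>Before polarization the only interacting points are \<open>x\<close> and the image of
  \<open>y\<close>, on opposite sides of the hyperplane. Polarization replaces the latter by
  \<open>y\<close> itself, which is strictly closer to \<open>x\<close>.\<close>

lemma quad_polarize_strict:
  assumes v: "v \<noteq> 0" and x: "x \<bullet> v < t" "x \<in> A" "hreflect v t x \<notin> A"
    and y: "y \<bullet> v < t" "y \<notin> B" "hreflect v t y \<in> B"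
  shows "quad v t A B x y < quad v t (polarize v t A) (polarize v t B) x y"
proof -
  have "norm (x - y) < norm (x - hreflect v t y)"
    using x(1) y(1) by (simp add: norm_less_hreflect_iff[OF v] mult_neg_neg)
  then have "k (x - hreflect v t y) < k (x - y)" by (rule decr)
  then show ?thesis
    using x y by (simp add: quad_def polarize_iff[OF v])
qed

lemma interaction_polarize:
  assumes [measurable]: "A \<in> sets borel" "B \<in> sets borel" and v: "v \<noteq> 0"
  shows "interaction k A B \<le> interaction k (polarize v t A) (polarize v t B)"
proof -
  have "4 * interaction k A B \<le> 4 * interaction k (polarize v t A) (polarize v t B)"
    by (simp flip: interaction_quad[of _ _ v t] add: nn_integral_mono quad_polarize v)
  then show ?thesis by (simp add: ennreal_mult_le_mult_iff)
qed

lemma interaction_le: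
  assumes [measurable]: "A \<in> sets borel" "B \<in> sets borel"
  shows "interaction k A B \<le> emeasure lborel A * (\<integral>\<^sup>+x. k x \<partial>lborel)"
proof -
  have "interaction k A B \<le> (\<integral>\<^sup>+x. indicator A x * (\<integral>\<^sup>+y. k (x - y) \<partial>lborel) \<partial>lborel)"
    unfolding interaction_def
    by (subst nn_integral_cmult[symmetric]) (auto intro!: nn_integral_mono simp: indicator_def)
  also have "\<dots> = emeasure lborel A * (\<integral>\<^sup>+x. k x \<partial>lborel)"
    by (simp add: nn_integral_lborel_reflect nn_integral_multc)
  finally show ?thesis .
qed

lemma interaction_polarize_eq:
  assumes [measurable]: "A \<in> sets borel" "B \<in> sets borel" and v: "v \<noteq> 0"
    and fin: "emeasure lborel A \<noteq> \<infinity>"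
    and eq: "interaction k (polarize v t A) (polarize v t B) = interaction k A B"
  shows "emeasure lborel {x. x \<bullet> v < t \<and> x \<in> A \<and> hreflect v t x \<notin> A} = 0 \<or>
         emeasure lborel {x. x \<bullet> v < t \<and> x \<notin> B \<and> hreflect v t x \<in> B} = 0"
proof (rule ccontr)
  let ?P = "{x. x \<bullet> v < t \<and> x \<in> A \<and> hreflect v t x \<notin> A}"
  let ?Q = "{x. x \<bullet> v < t \<and> x \<notin> B \<and> hreflect v t x \<in> B}"
  let ?f = "quad v t A B" and ?g = "quad v t (polarize v t A) (polarize v t B)"
  assume ne: "\<not> (emeasure lborel ?P = 0 \<or> emeasure lborel ?Q = 0)"
  have "interaction k A B \<noteq> \<infinity>"
    using interaction_le[of A B] fin integral_finite
    by (auto simp: ennreal_mult_eq_top_iff top_unique)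
  then have fin_g: "(\<integral>\<^sup>+x. \<integral>\<^sup>+y. ?g x y \<partial>lborel \<partial>lborel) \<noteq> \<infinity>"
    by (simp add: interaction_quad eq ennreal_mult_eq_top_iff)
  \<comment> \<open>Finiteness of the energy lets equality descend to the integrands. Two successive
    choices, \<open>x\<close> in \<open>?P\<close> and then \<open>y\<close> in \<open>?Q\<close>,
    contradict the strict pointwise inequality.\<close>
  have "AE x in lborel. (\<integral>\<^sup>+y. ?f x y \<partial>lborel) = (\<integral>\<^sup>+y. ?g x y \<partial>lborel)"
    using fin_g by (intro nn_integral_eq_imp_AE_eq)
      (auto simp: interaction_quad eq intro!: AE_I2 nn_integral_mono quad_polarize v)
  moreover have "AE x in lborel. (\<integral>\<^sup>+y. ?g x y \<partial>lborel) \<noteq> \<infinity>"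
    using fin_g by (intro nn_integral_PInf_AE) auto
  ultimately have "AE x in lborel. AE y in lborel. ?f x y = ?g x y"
  proof eventually_elim
    case (elim x)
    then show ?case
      by (intro nn_integral_eq_imp_AE_eq) (auto intro!: AE_I2 quad_polarize v)
  qed
  then obtain x where x: "x \<in> ?P" "AE y in lborel. ?f x y = ?g x y"
    using ne AE_positive_measure_ex[of _ lborel ?P] by auto
  obtain y where y: "y \<in> ?Q" "?f x y = ?g x y"
    using ne AE_positive_measure_ex[OF x(2), of ?Q] by auto
  then show False
    using x(1) y quad_polarize_strict[OF v, of x t A y B] by auto
qed

end

section \<open>Averaging over reflections\<close>

lemma ball_radius_exists:
  assumes "x \<noteq> (\<infinity> :: ennreal)"
  obtains r where "0 \<le> r" "emeasure lborel (ball (c :: 'a::euclidean_space) r) = x"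
proof -
  obtain a where a: "0 \<le> a" "x = ennreal a" using assms by (cases x) auto
  let ?V = "unit_ball_vol (real DIM('a))"
  define r where "r = root DIM('a) (a / ?V)"
  have V: "?V > 0" by simp
  have r: "0 \<le> r" using a V by (simp add: r_def real_root_ge_zero)
  have "?V * r ^ DIM('a) = a" using a V less_imp_neq[OF V] by (simp add: r_def real_root_pow_pos2)
  then have "emeasure lborel (ball c r) = x" using r a by (simp add: emeasure_ball)
  with r that show ?thesis by blast
qed

lemma emeasure_ball_less:
  assumes "0 \<le> r" "r < s"
  shows "emeasure lborel (ball (c :: 'a::euclidean_space) r) < emeasure lborel (ball (c' :: 'a) s)"
  using assms by (simp add: emeasure_ball ennreal_less_iff power_strict_mono)

lemma emeasure_ball_le_iff:
  assumes "0 \<le> r" "0 \<le> s"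
  shows "emeasure lborel (ball (c :: 'a::euclidean_space) r) \<le> emeasure lborel (ball (c' :: 'a) s) \<longleftrightarrow> r \<le> s"
  using assms emeasure_ball_less[of r s c c'] emeasure_ball_less[of s r c' c]
  by (metis emeasure_ball leD le_less linorder_not_less)

lemma emeasure_ball_neq_top [simp]: "emeasure lborel (ball (c :: 'a::euclidean_space) r) \<noteq> top"
  using emeasure_lborel_ball_finite[of c r] by auto

text \<open>Integrate \<open>|P \<inter> \<sigma>\<^sup>-\<^sup>1 Q|\<close> over bounded sets of normals \<open>v\<close> and levels \<open>t\<close>. For fixed \<open>x\<close> the substitution
  \<open>t = x \<bullet> v + s |v|\<^sup>2 / 2\<close> makes the mirror image equal to \<open>x + s v\<close>, so that for \<open>s \<in> [1, 2]\<close> the integral over \<open>v\<close>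
  is comparable to \<open>\<integral>\<^sub>Q |y - x|\<^sup>2 dy\<close>.\<close>

lemma hreflect_overlap_exists:
  fixes R m :: real
  assumes R: "R > 0" and m: "m > 0"
  obtains e where "e > 0"
    and "\<And>P Q. P \<in> sets borel \<Longrightarrow> Q \<in> sets borel \<Longrightarrow> P \<subseteq> ball (0 :: 'a::euclidean_space) R \<Longrightarrow>
      Q \<subseteq> ball 0 R \<Longrightarrow> ennreal m \<le> emeasure lborel P \<Longrightarrow> ennreal m \<le> emeasure lborel Q \<Longrightarrow>
      \<exists>v t. ennreal e \<le> emeasure lborel (P \<inter> hreflect v t -` Q)"
proof -
  let ?V = "unit_ball_vol (real DIM('a))"
  \<comment> \<open>A ball of radius \<eta> has measure at most \<open>m / 2\<close>, so at least
    half of the guaranteed mass of \<open>Q\<close> keeps distance \<eta> from any given point. The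
    cap at 1 gives \<eta>^D \<le> \<eta> in dimension D.\<close>
  define \<eta> where "\<eta> = min 1 (m / (2 * ?V))"
  have \<eta>: "0 < \<eta>" using m by (simp add: \<eta>_def)
  have "\<eta> ^ DIM('a) \<le> \<eta> ^ 1" using \<eta> by (intro power_decreasing) (auto simp: \<eta>_def DIM_positive Suc_leI)
  then have "\<eta> ^ DIM('a) \<le> m / (2 * ?V)" by (simp add: \<eta>_def)
  then have "?V * \<eta> ^ DIM('a) \<le> m / 2" by (simp add: field_simps)
  then have ball: "emeasure lborel (ball x \<eta>) \<le> ennreal (m / 2)" for x :: 'a
    using \<eta> by (simp add: emeasure_ball ennreal_leI)
  \<comment> \<open>For |x| < R, |v| < 2R and 1 \<le> s \<le> 2 the level x \<bullet> v + s |v|^2 /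
    2 has absolute value at most 2R^2 + 4R^2.\<close>
  define T where "T = 6 * R\<^sup>2"
  \<comment> \<open>\<open>C\<close> is the volume of the parameter set of pairs (v, t), and
    \<open>c\<close> is a lower bound for the integral of the overlap over it. The power 2^(D+3) is
    the value of s^D * 2 s^2 at s = 2. If all overlaps were at most \<open>c / (C + 1)\<close>, the
    integral would be at most c C / (C + 1) < c.\<close>
  define C where "C = measure lborel (ball (0 :: 'a) (2 * R)) * (2 * T)"
  define c where "c = m * (\<eta>\<^sup>2 * (m / 2) / 2 ^ (DIM('a) + 3))"
  have C: "C \<ge> 0" by (simp add: C_def T_def)
  have c: "c > 0" using m \<eta> by (simp add: c_def)
  have *: "\<exists>v t. ennreal (c / (C + 1)) \<le> emeasure lborel (P \<inter> hreflect v t -` Q)"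
    if [measurable]: "P \<in> sets borel" "Q \<in> sets borel" and sub: "P \<subseteq> ball (0 :: 'a) R" "Q \<subseteq> ball 0 R"
      and ge: "ennreal m \<le> emeasure lborel P" "ennreal m \<le> emeasure lborel Q" for P Q
  proof (rule ccontr)
    assume "\<not> ?thesis"
    then have less: "emeasure lborel (P \<inter> hreflect v t -` Q) \<le> ennreal (c / (C + 1))" for v t
      by (auto simp: not_le intro: less_imp_le)
    define h :: "'a \<Rightarrow> 'a \<Rightarrow> real \<Rightarrow> ennreal" where
      "h x v t = indicator P x * (indicator (ball 0 (2 * R)) v * (indicator {- T..T} t * indicator Q (hreflect v t x)))" for x v t
    have [measurable]: "ball (0 :: 'a) (2 * R) \<in> sets borel" by simp
    have [measurable]: "(\<lambda>(x, v, t). h x v t) \<in> borel_measurable (borel \<Otimes>\<^sub>M borel \<Otimes>\<^sub>M borel)"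
      unfolding h_def by measurable
    have [measurable]: "(\<lambda>(x, t). h x v t) \<in> borel_measurable (borel \<Otimes>\<^sub>M borel)" for v
      unfolding h_def by measurable
    define U where "U = (\<integral>\<^sup>+v. \<integral>\<^sup>+t. \<integral>\<^sup>+x. h x v t \<partial>lborel \<partial>lborel \<partial>lborel)"
    have "U \<le> (\<integral>\<^sup>+v. \<integral>\<^sup>+t. ennreal (c / (C + 1)) * (indicator (ball (0::'a) (2 * R)) v * indicator {- T..T} t) \<partial>lborel \<partial>lborel)"
      unfolding U_def
    proof (intro nn_integral_mono)
      fix v :: 'a and t :: real
      have "(\<integral>\<^sup>+x. h x v t \<partial>lborel) = (\<integral>\<^sup>+x. (indicator (ball 0 (2 * R)) v * indicator {- T..T} t) * indicator (P \<inter> hreflect v t -` Q) x \<partial>lborel)"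
        unfolding h_def by (intro nn_integral_cong) (auto simp: indicator_def)
      also have "\<dots> = (indicator (ball 0 (2 * R)) v * indicator {- T..T} t) * emeasure lborel (P \<inter> hreflect v t -` Q)"
        by (subst nn_integral_cmult) auto
      also have "\<dots> \<le> (indicator (ball 0 (2 * R)) v * indicator {- T..T} t) * ennreal (c / (C + 1))"
        by (intro mult_left_mono less) auto
      finally show "(\<integral>\<^sup>+x. h x v t \<partial>lborel) \<le> ennreal (c / (C + 1)) * (indicator (ball 0 (2 * R)) v * indicator {- T..T} t)"
        by (simp add: mult.commute)
    qed
    also have "\<dots> = ennreal (c / (C + 1)) * (emeasure lborel (ball (0::'a) (2 * R)) * emeasure lborel {- T..T})"
      by (simp add: nn_integral_cmult nn_integral_multc del: emeasure_lborel_Icc_eq emeasure_lborel_Icc)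
    also have "\<dots> = ennreal (c / (C + 1)) * ennreal C"
    proof -
      have "emeasure lborel (ball (0::'a) (2 * R)) = ennreal (measure lborel (ball (0::'a) (2 * R)))"
        by (intro emeasure_eq_ennreal_measure) simp
      moreover have "emeasure lborel {- T..T} = ennreal (2 * T)" by (simp add: T_def)
      ultimately show ?thesis by (simp add: C_def ennreal_mult T_def)
    qed
    also have "\<dots> = ennreal (c / (C + 1) * C)"
      using c C by (intro ennreal_mult[symmetric]) auto
    also have "\<dots> < ennreal c"
      using c C by (intro ennreal_lessI) (auto simp: field_simps)
    finally have U_less: "U < ennreal c" .
    have "U = (\<integral>\<^sup>+v. \<integral>\<^sup>+x. \<integral>\<^sup>+t. h x v t \<partial>lborel \<partial>lborel \<partial>lborel)"
      unfolding U_def by (intro nn_integral_cong lborel_pair.Fubini') simp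
    also have "\<dots> = (\<integral>\<^sup>+x. \<integral>\<^sup>+v. \<integral>\<^sup>+t. h x v t \<partial>lborel \<partial>lborel \<partial>lborel)"
      by (intro lborel_pair.Fubini') (simp add: h_def[abs_def])
    also have "\<dots> \<ge> (\<integral>\<^sup>+x. indicator P x * ennreal (\<eta>\<^sup>2 * (m / 2) / 2 ^ (DIM('a) + 3)) \<partial>lborel)"
    proof (rule nn_integral_mono)
      fix x :: 'a
      show "indicator P x * ennreal (\<eta>\<^sup>2 * (m / 2) / 2 ^ (DIM('a) + 3)) \<le> (\<integral>\<^sup>+v. \<integral>\<^sup>+t. h x v t \<partial>lborel \<partial>lborel)"
      proof (cases "x \<in> P")
        case True
        then have x: "norm x < R" using sub by auto
        \<comment> \<open>The factor |v|^2 / 2 is the derivative of \<open>t\<close> with respect to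
          \<open>s\<close>. The bound s \<ge> 1 forces |v| \<le> |s v| < 2R when \<open>x\<close>
          and \<open>x + s *\<^sub>R v\<close> lie in \<open>ball 0 R\<close>; the bound s \<le> 2
          controls the level and the dilation factor.\<close>
        define g :: "real \<Rightarrow> 'a \<Rightarrow> ennreal" where
          "g s v = indicator {1..2} s * (ennreal ((norm v)\<^sup>2 / 2) * indicator Q (x + s *\<^sub>R v))" for s v
        have [measurable]: "(\<lambda>(s, v). g s v) \<in> borel_measurable (borel \<Otimes>\<^sub>M borel)"
          unfolding g_def by measurable
        have lower: "ennreal (\<eta>\<^sup>2 * (m / 2) / 2 ^ (DIM('a) + 3)) \<le> (\<integral>\<^sup>+v. g s v \<partial>lborel)" if s: "s \<in> {1..2}" for s
        proof -
          let ?D = "DIM('a)"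
          have "ennreal (\<eta>\<^sup>2 * (m / 2)) \<le> (\<integral>\<^sup>+y. indicator Q y * ennreal ((norm (y - x))\<^sup>2) \<partial>lborel)"
          proof -
            have "ennreal m \<le> emeasure lborel (Q - ball x \<eta>) + emeasure lborel (ball x \<eta>)"
              using ge(2) emeasure_subadditive[of "Q - ball x \<eta>" lborel "ball x \<eta>"] emeasure_mono[of Q "Q - ball x \<eta> \<union> ball x \<eta>" lborel]
              by (auto intro: order_trans)
            also have "\<dots> \<le> emeasure lborel (Q - ball x \<eta>) + ennreal (m / 2)"
              by (intro add_left_mono ball)
            finally have "ennreal (m / 2) + ennreal (m / 2) \<le> ennreal (m / 2) + emeasure lborel (Q - ball x \<eta>)"
              using m by (simp add: add.commute flip: ennreal_plus)
            then have "ennreal (m / 2) \<le> emeasure lborel (Q - ball x \<eta>)"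
              unfolding ennreal_add_left_cancel_le by simp
            then have "ennreal (\<eta>\<^sup>2 * (m / 2)) \<le> ennreal (\<eta>\<^sup>2) * emeasure lborel (Q - ball x \<eta>)"
              using m by (subst ennreal_mult) (auto intro: mult_left_mono)
            also have "\<dots> = (\<integral>\<^sup>+y. ennreal (\<eta>\<^sup>2) * indicator (Q - ball x \<eta>) y \<partial>lborel)"
              by (subst nn_integral_cmult_indicator) auto
            also have "\<dots> \<le> (\<integral>\<^sup>+y. indicator Q y * ennreal ((norm (y - x))\<^sup>2) \<partial>lborel)"
              using \<eta> by (intro nn_integral_mono)
                (auto simp: indicator_def dist_norm norm_minus_commute intro!: ennreal_leI power_mono)
            finally show ?thesis .
          qed
          also have "\<dots> = ennreal (\<bar>s\<bar> ^ ?D) * (\<integral>\<^sup>+v. indicator Q (x + s *\<^sub>R v) * ennreal ((norm (x + s *\<^sub>R v - x))\<^sup>2) \<partial>lborel)"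
            using s by (intro nn_integral_lborel_affine[symmetric]) auto
          also have "\<dots> = ennreal (s ^ ?D) * (\<integral>\<^sup>+v. ennreal (2 * s\<^sup>2) * g s v \<partial>lborel)"
          proof -
            have "indicator Q (x + s *\<^sub>R v) * ennreal ((norm (x + s *\<^sub>R v - x))\<^sup>2) = ennreal (2 * s\<^sup>2) * g s v" for v
              using s by (simp add: g_def indicator_def power_mult_distrib flip: ennreal_mult)
            then show ?thesis using s by simp
          qed
          also have "\<dots> = ennreal (s ^ ?D * (2 * s\<^sup>2)) * (\<integral>\<^sup>+v. g s v \<partial>lborel)"
            using s by (simp add: nn_integral_cmult ennreal_mult mult.assoc)
          also have "\<dots> \<le> ennreal (2 ^ ?D * (2 * 2\<^sup>2)) * (\<integral>\<^sup>+v. g s v \<partial>lborel)"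
            using s by (intro mult_right_mono ennreal_leI mult_mono power_mono) auto
          also have "2 ^ ?D * (2 * 2\<^sup>2) = (2 ^ (?D + 3) :: real)"
            by (simp add: power_add)
          finally have "ennreal (\<eta>\<^sup>2 * (m / 2)) \<le> ennreal (2 ^ (?D + 3)) * (\<integral>\<^sup>+v. g s v \<partial>lborel)" .
          then have "ennreal (1 / 2 ^ (?D + 3)) * ennreal (\<eta>\<^sup>2 * (m / 2)) \<le> ennreal (1 / 2 ^ (?D + 3)) * (ennreal (2 ^ (?D + 3)) * (\<integral>\<^sup>+v. g s v \<partial>lborel))"
            by (rule mult_left_mono) simp
          then show ?thesis
            using m by (simp add: mult.commute[of _ "2 :: real"] flip: ennreal_mult mult.assoc)
        qed
        have "indicator P x * ennreal (\<eta>\<^sup>2 * (m / 2) / 2 ^ (DIM('a) + 3))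
            = (\<integral>\<^sup>+s. ennreal (\<eta>\<^sup>2 * (m / 2) / 2 ^ (DIM('a) + 3)) * indicator {1..2::real} s \<partial>lborel)"
          using True by (simp add: nn_integral_cmult)
        also have "\<dots> \<le> (\<integral>\<^sup>+s. \<integral>\<^sup>+v. g s v \<partial>lborel \<partial>lborel)"
          using lower by (intro nn_integral_mono) (simp add: indicator_def)
        also have "\<dots> = (\<integral>\<^sup>+v. \<integral>\<^sup>+s. g s v \<partial>lborel \<partial>lborel)"
          by (rule lborel_pair.Fubini') simp
        also have "\<dots> \<le> (\<integral>\<^sup>+v. \<integral>\<^sup>+t. h x v t \<partial>lborel \<partial>lborel)"
        proof (rule nn_integral_mono)
          fix v :: 'a
          show "(\<integral>\<^sup>+s. g s v \<partial>lborel) \<le> (\<integral>\<^sup>+t. h x v t \<partial>lborel)"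
          proof (cases "v = 0")
            case False
            let ?n = "(norm v)\<^sup>2 / 2"
            have n: "?n > 0" using False by simp
            have nv: "v \<bullet> v = (norm v)\<^sup>2" by (simp add: power2_norm_eq_inner)
            have refl: "hreflect v (x \<bullet> v + ?n * s) x = x + s *\<^sub>R v" for s
              using False by (simp add: hreflect_def nv)
            have "(\<integral>\<^sup>+s. g s v \<partial>lborel) \<le> (\<integral>\<^sup>+s. ennreal ?n * h x v (x \<bullet> v + ?n * s) \<partial>lborel)"
            proof (rule nn_integral_mono)
              fix s :: real
              show "g s v \<le> ennreal ?n * h x v (x \<bullet> v + ?n * s)"
              proof (cases "s \<in> {1..2} \<and> x + s *\<^sub>R v \<in> Q")
                case True
                then have s: "1 \<le> s" "s \<le> 2" and y: "norm (x + s *\<^sub>R v) < R" using sub by auto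
                have "norm v \<le> norm (s *\<^sub>R v)" using s by (simp add: mult_le_cancel_right1)
                also have "\<dots> < 2 * R"
                  using norm_triangle_ineq4[of "x + s *\<^sub>R v" x] x y by simp
                finally have v: "norm v < 2 * R" .
                have "\<bar>x \<bullet> v\<bar> \<le> R * (2 * R)"
                  using Cauchy_Schwarz_ineq2[of x v] x v mult_mono[of "norm x" R "norm v" "2 * R"] R by simp
                moreover have "(norm v)\<^sup>2 \<le> (2 * R)\<^sup>2" using v by (intro power_mono) auto
                then have "?n * s \<le> (2 * R)\<^sup>2 / 2 * 2" using s by (intro mult_mono) auto
                moreover have "0 \<le> ?n * s" using s by simp
                ultimately have "x \<bullet> v + ?n * s \<in> {- T..T}"
                  by (simp add: T_def power2_eq_square abs_le_iff)
                then show ?thesis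
                  using True v \<open>x \<in> P\<close> unfolding g_def h_def refl by simp
              qed (auto simp: g_def)
            qed
            also have "\<dots> = ennreal ?n * (\<integral>\<^sup>+s. h x v (x \<bullet> v + ?n * s) \<partial>lborel)"
              by (rule nn_integral_cmult) simp
            also have "\<dots> = (\<integral>\<^sup>+t. h x v t \<partial>lborel)"
              using nn_integral_real_affine[of "h x v" ?n "x \<bullet> v"] n by simp
            finally show ?thesis .
          qed (simp add: g_def)
        qed
        finally show ?thesis .
      qed simp
    qed
    also have "(\<integral>\<^sup>+x. indicator P x * ennreal (\<eta>\<^sup>2 * (m / 2) / 2 ^ (DIM('a) + 3)) \<partial>lborel)
        = emeasure lborel P * ennreal (\<eta>\<^sup>2 * (m / 2) / 2 ^ (DIM('a) + 3))"
      by (simp add: nn_integral_multc)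
    finally have "emeasure lborel P * ennreal (\<eta>\<^sup>2 * (m / 2) / 2 ^ (DIM('a) + 3)) \<le> U" .
    moreover have "ennreal c = ennreal m * ennreal (\<eta>\<^sup>2 * (m / 2) / 2 ^ (DIM('a) + 3))"
      unfolding c_def by (rule ennreal_mult) (use m in auto)
    moreover have "\<dots> \<le> emeasure lborel P * ennreal (\<eta>\<^sup>2 * (m / 2) / 2 ^ (DIM('a) + 3))"
      by (intro mult_right_mono ge) simp
    ultimately show False using U_less by simp
  qed
  have "c / (C + 1) > 0" using c C by simp
  then show thesis using * by (rule that)
qed

section \<open>Riesz' inequality for two sets\<close>

text \<open>For \<open>t \<ge> 0\<close> the origin is not on the unfavoured side, so a centred ball
  is already polarized and \<open>A \<inter> ball 0 r\<close> loses no mass. A point of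
  \<open>A\<close> outside the ball whose image lies in the ball but not in \<open>A\<close> is
  exchanged for that image, which is the gain.\<close>

lemma emeasure_polarize_Int_ball:
  fixes A :: "'a::euclidean_space set"
  assumes [measurable]: "A \<in> sets borel" and v: "v \<noteq> 0" and t: "t \<ge> 0"
  shows "emeasure lborel (A \<inter> ball 0 r) + emeasure lborel ((A - ball 0 r) \<inter> hreflect v t -` (ball 0 r - A))
      \<le> emeasure lborel (polarize v t A \<inter> ball 0 r)"
proof -
  let ?h = "hreflect v t" and ?b = "ball (0 :: 'a) r"
  let ?P = "(A - ?b) \<inter> ?h -` (?b - A)" and ?A = "polarize v t A"
  have [measurable]: "?b \<in> sets borel" by simp
  have meas [measurable]: "A \<inter> ?b \<in> sets borel" "?P \<in> sets borel" "?A \<inter> ?b \<in> sets borel" by measurable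
  have 1: "?h x \<in> ?b \<Longrightarrow> x \<in> ?b" if "x \<bullet> v < t" for x
    using norm_le_hreflect[OF v, of x t 0] that t by (auto simp: mult_nonpos_nonneg mult_le_0_iff)
  have 2: "x \<in> ?b \<Longrightarrow> ?h x \<in> ?b" if "\<not> x \<bullet> v < t" for x
    using norm_ge_hreflect[OF v, of x t 0] that t by (auto simp: mult_nonneg_nonneg zero_le_mult_iff)
  define ind where "ind S x = (indicator S x + indicator S (?h x) :: ennreal)" for S x
  have int: "(\<integral>\<^sup>+x. ind S x \<partial>lborel) = 2 * emeasure lborel S" if "S \<in> sets borel" for S
    using nn_integral_add_hreflect[of "indicator S" v t] that by (simp add: ind_def)
  have "2 * (emeasure lborel (A \<inter> ?b) + emeasure lborel ?P) = (\<integral>\<^sup>+x. ind (A \<inter> ?b) x + ind ?P x \<partial>lborel)"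
  proof -
    have "ind S \<in> borel_measurable lborel" if [measurable]: "S \<in> sets borel" for S
      unfolding ind_def[abs_def] by measurable
    then show ?thesis by (simp add: nn_integral_add int distrib_left)
  qed
  also have "\<dots> \<le> (\<integral>\<^sup>+x. ind (?A \<inter> ?b) x \<partial>lborel)"
  proof (rule nn_integral_mono)
    fix x
    show "ind (A \<inter> ?b) x + ind ?P x \<le> ind (?A \<inter> ?b) x"
      using polarize_iff[OF v, of x t A] 1[of x] 2[of x] unfolding ind_def
      by (cases "x \<bullet> v < t"; cases "x \<in> A"; cases "?h x \<in> A"; cases "x \<in> ?b"; cases "?h x \<in> ?b")
        (simp_all del: mem_ball)
  qed
  also have "\<dots> = 2 * emeasure lborel (?A \<inter> ?b)"
    by (simp add: int)
  finally show ?thesis by (subst (asm) ennreal_mult_le_mult_iff) auto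
qed

text \<open>A single point that the reflection moves closer to \<open>c\<close> shows that
  \<open>c\<close> is off the hyperplane, on the side of the image. Changing the sign of normal and
  level, if necessary, makes this the favoured side without changing the reflection.\<close>

lemma hreflect_closer:
  fixes c :: "'a::real_inner"
  assumes "norm (hreflect v t x - c) < norm (x - c)"
  obtains w s where "w \<noteq> 0" "c \<bullet> w < s" "hreflect w s = hreflect v t" "hreflect v t x \<bullet> w < s"
proof -
  have v: "v \<noteq> 0"
  proof
    assume "v = 0"
    then have "hreflect v t x = x" by (simp add: hreflect_def)
    with assms show False by simp
  qed
  let ?y = "hreflect v t x"
  have "(?y \<bullet> v - t) * (c \<bullet> v - t) > 0"
    using assms norm_less_hreflect_iff[OF v, of c ?y t] by (simp only: norm_minus_commute[of c] hreflect_hreflect)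
  then consider "?y \<bullet> v < t" "c \<bullet> v < t" | "t < ?y \<bullet> v" "t < c \<bullet> v"
    unfolding zero_less_mult_iff by linarith
  then show ?thesis
  proof cases
    case 1
    show ?thesis by (rule that[OF v 1(2) refl 1(1)])
  next
    case 2
    show ?thesis
    proof (rule that)
      show "hreflect (- v) (- t) = hreflect v t" by (rule ext) (rule hreflect_uminus)
    qed (use v 2 in auto)
  qed
qed

text \<open>Equal volumes make \<open>ball 0 r - A\<close> as large as \<open>A - ball 0 r\<close>,
  so some reflection carries a definite amount of the latter into the former. What matters is that
  \<open>e\<close> depends on \<open>R\<close> and \<open>m\<close> only, and not on
  \<open>A\<close> or \<open>r\<close>.\<close>

lemma polarize_gain_exists:
  fixes R m :: real
  assumes R: "R > 0" and m: "m > 0"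
  obtains e where "e > 0"
    and "\<And>A r. A \<in> sets borel \<Longrightarrow> A \<subseteq> ball (0 :: 'a::euclidean_space) R \<Longrightarrow> r \<le> R \<Longrightarrow>
      emeasure lborel A = emeasure lborel (ball (0 :: 'a) r) \<Longrightarrow>
      ennreal m \<le> emeasure lborel (A - ball 0 r) \<Longrightarrow>
      \<exists>v t. v \<noteq> 0 \<and> t \<ge> 0 \<and>
        emeasure lborel (A \<inter> ball 0 r) + ennreal e \<le> emeasure lborel (polarize v t A \<inter> ball 0 r)"
proof (rule hreflect_overlap_exists[OF R m, where 'a='a])
  fix e :: real
  assume e: "e > 0" and ov: "\<And>P Q. P \<in> sets borel \<Longrightarrow> Q \<in> sets borel \<Longrightarrow>
      P \<subseteq> ball (0 :: 'a) R \<Longrightarrow> Q \<subseteq> ball 0 R \<Longrightarrow>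
      ennreal m \<le> emeasure lborel P \<Longrightarrow> ennreal m \<le> emeasure lborel Q \<Longrightarrow>
      \<exists>v t. ennreal e \<le> emeasure lborel (P \<inter> hreflect v t -` Q)"
  show thesis
  proof (rule that[OF e])
    fix A r
    assume [measurable]: "A \<in> sets borel" and A: "A \<subseteq> ball (0 :: 'a) R" and r: "r \<le> R"
      and eq: "emeasure lborel A = emeasure lborel (ball (0 :: 'a) r)"
      and ge: "ennreal m \<le> emeasure lborel (A - ball 0 r)"
    let ?b = "ball (0 :: 'a) r"
    have [measurable]: "?b \<in> sets borel" by simp
    have "emeasure lborel (?b - A) = emeasure lborel (A - ?b)"
      using emeasure_Diff_eq[of A lborel ?b] eq by simp
    then have "\<exists>v t. ennreal e \<le> emeasure lborel ((A - ?b) \<inter> hreflect v t -` (?b - A))"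
      using A r ge by (intro ov) auto
    then obtain v t where le: "ennreal e \<le> emeasure lborel ((A - ?b) \<inter> hreflect v t -` (?b - A))"
      by blast
    \<comment> \<open>One point of the overlap suffices to orient the hyperplane with the origin on
      the favoured side.\<close>
    then have "(A - ?b) \<inter> hreflect v t -` (?b - A) \<noteq> {}" using e by (auto simp del: Diff_iff)
    then obtain x where "x \<in> A - ?b" "hreflect v t x \<in> ?b - A" by blast
    then have "norm (hreflect v t x - 0) < norm (x - 0)" by auto
    then obtain w s where w: "w \<noteq> 0" "0 \<bullet> w < s" "hreflect w s = hreflect v t"
      by (rule hreflect_closer)
    have "emeasure lborel (A \<inter> ?b) + ennreal e \<le> emeasure lborel (polarize w s A \<inter> ?b)"
      using emeasure_polarize_Int_ball[of A w s r] w le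
      by (auto intro: order_trans[OF add_left_mono[OF le]])
    then show "\<exists>v t. v \<noteq> 0 \<and> t \<ge> 0 \<and> emeasure lborel (A \<inter> ?b) + ennreal e \<le> emeasure lborel (polarize v t A \<inter> ?b)"
      using w by (auto intro: less_imp_le)
  qed
qed

lemma polarize_subset_ball:
  assumes "A \<subseteq> ball 0 R" "t \<ge> 0"
  shows "polarize v t A \<subseteq> ball (0 :: 'a::real_inner) R"
proof
  fix x assume x: "x \<in> polarize v t A"
  have "x \<in> ball 0 R" if h: "hreflect v t x \<in> A" "x \<bullet> v < t"
  proof (cases "v = 0")
    case False
    have "(x \<bullet> v - t) * t \<le> 0" using h(2) assms(2) by (intro mult_nonpos_nonneg) auto
    then have "norm x \<le> norm (hreflect v t x)"
      using norm_le_hreflect[OF False, of x t 0] by simp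
    then show ?thesis using h assms(1) by auto
  qed (use h assms in \<open>auto simp: hreflect_def\<close>)
  with x show "x \<in> ball 0 R" using assms by (auto simp: polarize_def split: if_splits)
qed

context radial_kernel
begin

lemma interaction_commute:
  assumes [measurable]: "A \<in> sets borel" "B \<in> sets borel"
  shows "interaction k A B = interaction k B A"
proof -
  have "interaction k A B = (\<integral>\<^sup>+y. \<integral>\<^sup>+x. indicator A x * indicator B y * k (x - y) \<partial>lborel \<partial>lborel)"
    unfolding interaction_def by (rule lborel_pair.Fubini') simp
  also have "\<dots> = interaction k B A"
    unfolding interaction_def
    by (intro nn_integral_cong) (metis mult.commute norm_minus_commute radial)
  finally show ?thesis .
qed

lemma interaction_mono: "A \<subseteq> A' \<Longrightarrow> B \<subseteq> B' \<Longrightarrow> interaction k A B \<le> interaction k A' B'"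
  unfolding interaction_def by (intro nn_integral_mono) (auto simp: indicator_def)

text \<open>Continuity of the interaction with respect to measure, with the integral of the kernel
  as Lipschitz constant: replace one set at a time and enlarge the other to the whole space in the
  error term.\<close>

lemma interaction_le_add:
  assumes [measurable]: "A \<in> sets borel" "B \<in> sets borel" "A' \<in> sets borel" "B' \<in> sets borel"
  shows "interaction k A B \<le> interaction k A' B'
    + (emeasure lborel (A - A') + emeasure lborel (B - B')) * (\<integral>\<^sup>+x. k x \<partial>lborel)"
proof -
  have "interaction k A B \<le> (\<integral>\<^sup>+x. \<integral>\<^sup>+y. indicator A' x * indicator B' y * k (x - y)
      + (indicator (A - A') x * indicator UNIV y * k (x - y) + indicator UNIV x * indicator (B - B') y * k (x - y)) \<partial>lborel \<partial>lborel)"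
    unfolding interaction_def
    by (intro nn_integral_mono) (auto simp: indicator_def)
  also have "\<dots> = interaction k A' B' + (interaction k (A - A') UNIV + interaction k UNIV (B - B'))"
    unfolding interaction_def by (simp add: nn_integral_add)
  also have "\<dots> = interaction k A' B' + (interaction k (A - A') UNIV + interaction k (B - B') UNIV)"
    by (simp add: interaction_commute[of UNIV])
  also have "\<dots> \<le> interaction k A' B' + (emeasure lborel (A - A') * (\<integral>\<^sup>+x. k x \<partial>lborel) + emeasure lborel (B - B') * (\<integral>\<^sup>+x. k x \<partial>lborel))"
    by (intro add_left_mono add_mono interaction_le) auto
  finally show ?thesis by (simp add: distrib_right)
qed

text \<open>\<open>S\<close> is closed under polarization with \<open>t \<ge> 0\<close>, and
  \<open>M\<close> is the supremum over \<open>S\<close> of the total overlap with the two balls. It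
  need not be attained: a pair whose overlap is within \<open>e\<close> of \<open>M\<close> already
  has \<open>m\<close>-small defects, as otherwise one polarization would exceed \<open>M\<close>.
  The same polarization acts on both sets, but by \<open>inc\<close> it cannot reduce the overlap of
  the other one.\<close>

lemma interaction_le_balls_bounded:
  assumes [measurable]: "A \<in> sets borel" "B \<in> sets borel"
    and R: "R > 0" and sub: "A \<subseteq> ball 0 R" "B \<subseteq> ball 0 R" and ab: "a \<le> R" "b \<le> R"
    and A: "emeasure lborel A = emeasure lborel (ball (0 :: 'a) a)"
    and B: "emeasure lborel B = emeasure lborel (ball (0 :: 'a) b)"
  shows "interaction k A B \<le> interaction k (ball 0 a) (ball 0 b)"
proof -
  define S where "S = {(A', B'). A' \<in> sets borel \<and> B' \<in> sets borel \<and> A' \<subseteq> ball 0 R \<and> B' \<subseteq> ball 0 R \<and>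
     emeasure lborel A' = emeasure lborel A \<and> emeasure lborel B' = emeasure lborel B \<and>
     interaction k A B \<le> interaction k A' B'}"
  define \<Psi> where "\<Psi> = (\<lambda>(A', B'). emeasure lborel (A' \<inter> ball (0 :: 'a) a) + emeasure lborel (B' \<inter> ball (0 :: 'a) b))"
  define M where "M = (SUP X\<in>S. \<Psi> X)"
  have AB: "(A, B) \<in> S" using sub by (auto simp: S_def)
  have pol: "(polarize v t A', polarize v t B') \<in> S" if "(A', B') \<in> S" "v \<noteq> 0" "t \<ge> 0" for A' B' v t
    using that interaction_polarize[of A' B' v t]
    by (auto simp: S_def emeasure_polarize polarize_subset_ball dest: order_trans intro: subsetD[OF polarize_subset_ball])
  have inc: "emeasure lborel (A' \<inter> ball 0 r) \<le> emeasure lborel (polarize v t A' \<inter> ball (0 :: 'a) r)"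
    if "A' \<in> sets borel" "v \<noteq> 0" "t \<ge> 0" for A' v t r
    using emeasure_polarize_Int_ball[OF that, of r] by (rule order_trans[rotated]) simp
  have le_M: "\<Psi> X \<le> M" if "X \<in> S" for X unfolding M_def using that by (rule SUP_upper)
  have "M \<le> emeasure lborel (ball (0::'a) a) + emeasure lborel (ball (0::'a) b)"
    unfolding M_def \<Psi>_def by (intro SUP_least) (auto intro!: add_mono emeasure_mono)
  moreover have "emeasure lborel (ball (0::'a) a) + emeasure lborel (ball (0::'a) b) \<noteq> \<infinity>"
    by simp
  ultimately have M: "M \<noteq> \<infinity>" by (auto simp: top_unique)
  have close: "\<exists>A' B'. (A', B') \<in> S \<and> emeasure lborel (A' - ball 0 a) \<le> ennreal m \<and> emeasure lborel (B' - ball 0 b) \<le> ennreal m"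
    if m: "m > 0" for m
  proof (rule polarize_gain_exists[OF R m, where 'a='a])
    fix e :: real
    assume e: "e > 0" and gain: "\<And>A r. A \<in> sets borel \<Longrightarrow> A \<subseteq> ball (0 :: 'a) R \<Longrightarrow> r \<le> R \<Longrightarrow>
      emeasure lborel A = emeasure lborel (ball (0 :: 'a) r) \<Longrightarrow>
      ennreal m \<le> emeasure lborel (A - ball 0 r) \<Longrightarrow>
      \<exists>v t. v \<noteq> 0 \<and> t \<ge> 0 \<and>
        emeasure lborel (A \<inter> ball 0 r) + ennreal e \<le> emeasure lborel (polarize v t A \<inter> ball 0 r)"
    have "\<exists>X\<in>S. M < \<Psi> X + ennreal e"
    \<comment> \<open>Subtraction in \<open>ennreal\<close> is truncated, so
      \<open>M - ennreal e < M\<close> requires \<open>M \<noteq> 0\<close>.\<close>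
    proof (cases "M = 0")
      case True
      then show ?thesis using AB e by (intro bexI[of _ "(A, B)"]) (simp_all add: zero_less_iff_neq_zero)
    next
      case False
      then have "M - ennreal e < M"
        using M e by (intro ennreal_between) (auto simp: less_top zero_less_iff_neq_zero)
      then obtain X where "X \<in> S" "M - ennreal e < \<Psi> X"
        unfolding M_def less_SUP_iff by blast
      have "M < \<Psi> X + ennreal e"
      proof (rule ccontr)
        assume "\<not> ?thesis"
        then have "(\<Psi> X + ennreal e) - ennreal e \<le> M - ennreal e"
          by (intro ennreal_minus_mono) auto
        with \<open>M - ennreal e < \<Psi> X\<close> show False by simp
      qed
      with \<open>X \<in> S\<close> show ?thesis by blast
    qed
    then obtain A' B' where S: "(A', B') \<in> S" and gt: "M < \<Psi> (A', B') + ennreal e" by auto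
    then have meas [measurable]: "A' \<in> sets borel" "B' \<in> sets borel" by (auto simp: S_def)
    have no_gain: False if v: "v \<noteq> 0" "t \<ge> 0"
      and "emeasure lborel (A' \<inter> ball 0 a) + ennreal e \<le> emeasure lborel (polarize v t A' \<inter> ball 0 a) \<or>
           emeasure lborel (B' \<inter> ball 0 b) + ennreal e \<le> emeasure lborel (polarize v t B' \<inter> ball 0 b)" for v t
    proof -
      have "\<Psi> (A', B') + ennreal e \<le> \<Psi> (polarize v t A', polarize v t B')"
        using that(3)
      proof
        assume "emeasure lborel (A' \<inter> ball 0 a) + ennreal e \<le> emeasure lborel (polarize v t A' \<inter> ball 0 a)"
        from add_mono[OF this inc[OF meas(2) v, of b]] show ?thesis by (simp add: \<Psi>_def ac_simps)
      next
        assume "emeasure lborel (B' \<inter> ball 0 b) + ennreal e \<le> emeasure lborel (polarize v t B' \<inter> ball 0 b)"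
        from add_mono[OF inc[OF meas(1) v, of a] this] show ?thesis by (simp add: \<Psi>_def ac_simps)
      qed
      also have "\<dots> \<le> M" by (rule le_M[OF pol[OF S v]])
      finally show False using gt by simp
    qed
    have "emeasure lborel (A' - ball 0 a) \<le> ennreal m"
    proof (rule ccontr)
      assume "\<not> ?thesis"
      then have "ennreal m \<le> emeasure lborel (A' - ball 0 a)" by simp
      then have "\<exists>v t. v \<noteq> 0 \<and> t \<ge> 0 \<and> emeasure lborel (A' \<inter> ball 0 a) + ennreal e \<le> emeasure lborel (polarize v t A' \<inter> ball 0 a)"
        using S ab A by (intro gain) (auto simp: S_def)
      then show False using no_gain by blast
    qed
    moreover have "emeasure lborel (B' - ball 0 b) \<le> ennreal m"
    proof (rule ccontr)
      assume "\<not> ?thesis"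
      then have "ennreal m \<le> emeasure lborel (B' - ball 0 b)" by simp
      then have "\<exists>v t. v \<noteq> 0 \<and> t \<ge> 0 \<and> emeasure lborel (B' \<inter> ball 0 b) + ennreal e \<le> emeasure lborel (polarize v t B' \<inter> ball 0 b)"
        using S ab B by (intro gain) (auto simp: S_def)
      then show False using no_gain by blast
    qed
    ultimately show ?thesis using S by blast
  qed
  obtain K where K: "K \<ge> 0" "(\<integral>\<^sup>+x. k x \<partial>lborel) = ennreal K"
    using integral_finite by (cases "\<integral>\<^sup>+x. k x \<partial>lborel") auto
  show ?thesis
  proof (rule ennreal_le_epsilon)
    fix d :: real assume d: "d > 0"
    \<comment> \<open>The two defects together cost at most 2 m K, which is at most
      \<open>d\<close>.\<close>
    define m where "m = d / (2 * (K + 1))"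
    have m: "m > 0" using d K by (simp add: m_def)
    obtain A' B' where S: "(A', B') \<in> S" and c: "emeasure lborel (A' - ball 0 a) \<le> ennreal m" "emeasure lborel (B' - ball 0 b) \<le> ennreal m"
      using close[OF m] by blast
    then have [measurable]: "A' \<in> sets borel" "B' \<in> sets borel" by (auto simp: S_def)
    have "interaction k A B \<le> interaction k A' B'" using S by (auto simp: S_def)
    also have "\<dots> \<le> interaction k (ball 0 a) (ball 0 b) + (emeasure lborel (A' - ball 0 a) + emeasure lborel (B' - ball 0 b)) * (\<integral>\<^sup>+x. k x \<partial>lborel)"
      by (rule interaction_le_add) auto
    also have "\<dots> \<le> interaction k (ball 0 a) (ball 0 b) + (ennreal m + ennreal m) * ennreal K"
      unfolding K(2) by (intro add_left_mono mult_right_mono add_mono c) auto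
    also have "(ennreal m + ennreal m) * ennreal K = ennreal (2 * m * K)"
      using m K by (simp flip: ennreal_plus ennreal_mult)
    also have "\<dots> \<le> ennreal d"
      using d K by (intro ennreal_leI) (auto simp: m_def field_simps)
    finally show "interaction k A B \<le> interaction k (ball 0 a) (ball 0 b) + ennreal d"
      by (simp add: add_left_mono)
  qed
qed

text \<open>Truncation to \<open>ball 0 n\<close> reduces this to bounded sets. The discarded parts
  have measure tending to 0, and so does their share of the interaction.\<close>

theorem interaction_le_balls:
  assumes [measurable]: "A \<in> sets borel" "B \<in> sets borel" and ab: "0 \<le> a" "0 \<le> b"
    and A: "emeasure lborel A = emeasure lborel (ball (0 :: 'a) a)"
    and B: "emeasure lborel B = emeasure lborel (ball (0 :: 'a) b)"
  shows "interaction k A B \<le> interaction k (ball 0 a) (ball 0 b)"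
proof -
  let ?K = "\<integral>\<^sup>+x. k x \<partial>lborel"
  define x where "x n = emeasure lborel (A - ball 0 (real n)) + emeasure lborel (B - ball 0 (real n))" for n
  have trunc: "(\<lambda>n. emeasure lborel (C - ball 0 (real n))) \<longlonglongrightarrow> 0"
    if [measurable]: "C \<in> sets borel" and fin: "emeasure lborel C \<noteq> \<infinity>" for C :: "'a set"
  proof -
    have "(\<lambda>n. emeasure lborel (C - ball 0 (real n))) \<longlonglongrightarrow> emeasure lborel (\<Inter>n. C - ball 0 (real n))"
    proof (rule Lim_emeasure_decseq)
      show "range (\<lambda>n. C - ball 0 (real n)) \<subseteq> sets lborel" by auto
      show "decseq (\<lambda>n. C - ball 0 (real n))" by (auto simp: decseq_def)
      show "emeasure lborel (C - ball 0 (real n)) \<noteq> \<infinity>" for n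
        using emeasure_mono[of "C - ball 0 (real n)" C lborel] fin by (auto simp: top_unique)
    qed
    also have "(\<Inter>n. C - ball 0 (real n)) = {}"
    proof -
      have "\<exists>n. norm y < real n" for y :: 'a by (rule reals_Archimedean2)
      then show ?thesis by fastforce
    qed
    finally show ?thesis by simp
  qed
  have "(\<lambda>n. emeasure lborel (A - ball 0 (real n)) + emeasure lborel (B - ball 0 (real n))) \<longlonglongrightarrow> 0 + 0"
    using A B by (intro tendsto_add trunc) auto
  then have "(\<lambda>n. ?K * x n) \<longlonglongrightarrow> ?K * 0"
    unfolding x_def using integral_finite by (intro ennreal_tendsto_cmult) (auto simp: less_top)
  then have lim: "(\<lambda>n. interaction k (ball 0 a) (ball 0 b) + ?K * x n) \<longlonglongrightarrow> interaction k (ball 0 a) (ball 0 b) + ?K * 0"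
    by (intro tendsto_add tendsto_const)
  have le: "interaction k A B \<le> interaction k (ball 0 a) (ball 0 b) + ?K * x n" if n: "n > 0" for n
  proof -
    let ?A = "A \<inter> ball 0 (real n)" and ?B = "B \<inter> ball 0 (real n)"
    \<comment> \<open>The bound by \<open>real n\<close> puts the rearranged truncation into the
      truncating ball, as the bounded case demands; the bound by \<open>c\<close> lets its ball be
      enlarged to that of the whole set afterwards.\<close>
    have rad: "\<exists>r. 0 \<le> r \<and> r \<le> c \<and> r \<le> real n \<and> emeasure lborel (C \<inter> ball 0 (real n)) = emeasure lborel (ball (0 :: 'a) r)"
      if [measurable]: "C \<in> sets borel" and C: "emeasure lborel C = emeasure lborel (ball (0 :: 'a) c)" "0 \<le> c" for C :: "'a set" and c
    proof -
      have le: "emeasure lborel (C \<inter> ball 0 (real n)) \<le> emeasure lborel (ball (0 :: 'a) c)"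
        unfolding C(1)[symmetric] by (intro emeasure_mono) auto
      then have "emeasure lborel (C \<inter> ball 0 (real n)) \<noteq> \<infinity>"
        using emeasure_ball_neq_top[of 0 c] by (auto simp: top_unique)
      then obtain r where r: "0 \<le> r" "emeasure lborel (ball (0 :: 'a) r) = emeasure lborel (C \<inter> ball 0 (real n))"
        by (rule ball_radius_exists)
      have "emeasure lborel (ball (0 :: 'a) r) \<le> emeasure lborel (ball (0 :: 'a) (real n))"
        unfolding r(2) by (rule emeasure_mono) auto
      moreover have "emeasure lborel (ball (0 :: 'a) r) \<le> emeasure lborel (ball (0 :: 'a) c)"
        unfolding r by (rule le)
      ultimately show ?thesis
        using r C(2) by (subst (asm) (1 2) emeasure_ball_le_iff) auto
    qed
    obtain a' where a': "0 \<le> a'" "a' \<le> a" "a' \<le> real n" "emeasure lborel ?A = emeasure lborel (ball (0 :: 'a) a')"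
      using rad[OF _ A ab(1)] by auto
    obtain b' where b': "0 \<le> b'" "b' \<le> b" "b' \<le> real n" "emeasure lborel ?B = emeasure lborel (ball (0 :: 'a) b')"
      using rad[OF _ B ab(2)] by auto
    have "interaction k A B \<le> interaction k ?A ?B + (emeasure lborel (A - ?A) + emeasure lborel (B - ?B)) * ?K"
      by (rule interaction_le_add) auto
    also have "\<dots> = interaction k ?A ?B + ?K * x n"
      by (simp add: x_def Diff_Int mult.commute)
    also have "interaction k ?A ?B \<le> interaction k (ball 0 a') (ball 0 b')"
      by (rule interaction_le_balls_bounded[where R="real n"]) (use a' b' n in auto)
    also have "\<dots> \<le> interaction k (ball 0 a) (ball 0 b)"
      using a' b' by (intro interaction_mono subset_ball) auto
    finally show ?thesis by (simp add: add_right_mono)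
  qed
  show ?thesis
  proof -
    have "interaction k A B \<le> interaction k (ball 0 a) (ball 0 b) + ?K * 0"
      by (rule LIMSEQ_le_const[OF lim]) (use le in \<open>auto intro!: exI[of _ 1]\<close>)
    then show ?thesis by simp
  qed
qed

end

section \<open>Equality in Riesz' inequality\<close>

lemma emeasure_vimage_hreflect:
  assumes "S \<in> sets borel"
  shows "emeasure lborel (hreflect (v :: 'a::euclidean_space) t -` S) = emeasure lborel S"
  using emeasure_distr[of "hreflect v t" lborel borel S] assms by (simp add: distr_lborel_hreflect)

lemma AE_hreflect:
  assumes "AE x in lborel. P x"
  shows "AE x in lborel. P (hreflect (v :: 'a::euclidean_space) t x)"
proof -
  obtain N where N: "{x. \<not> P x} \<subseteq> N" "N \<in> sets borel" "emeasure lborel N = 0"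
    using assms by (auto elim!: AE_E)
  then have "hreflect v t -` N \<in> null_sets lborel"
    by (auto simp: emeasure_vimage_hreflect)
  then show ?thesis
    by (rule AE_I') (use N in auto)
qed

text \<open>The centre is the barycentre of the set of all points whose ball of a fixed large radius contains more than
  half of \<open>B\<close>. Unlike \<open>B\<close> this set is bounded, and it inherits from \<open>B\<close> the preference for one side of a
  hyperplane.\<close>

lemma center_exists:
  fixes B :: "'a::euclidean_space set"
  assumes [measurable]: "B \<in> sets borel" and B: "emeasure lborel B \<noteq> 0" "emeasure lborel B \<noteq> \<infinity>"
  obtains c where "\<And>v t. v \<noteq> 0 \<Longrightarrow>
    emeasure lborel {x. x \<bullet> v < t \<and> x \<in> B \<and> hreflect v t x \<notin> B} = 0 \<Longrightarrow> t \<le> c \<bullet> v"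
proof -
  obtain b where b: "b > 0" "emeasure lborel B = ennreal b"
    using B by (cases "emeasure lborel B") (auto simp: less_le)
  have "ennreal (b / 2) < emeasure lborel B" using b by (simp add: ennreal_less_iff)
  also have "emeasure lborel B = (SUP n. emeasure lborel (B \<inter> ball 0 (real n)))"
    by (rule emeasure_SUP_Int_ball) measurable
  finally obtain n where n: "ennreal (b / 2) < emeasure lborel (B \<inter> ball 0 (real n))"
    by (auto simp: less_SUP_iff)
  \<comment> \<open>Balls of radius n + 1 around points of the unit ball contain
    \<open>ball 0 n\<close>, and with it more than half of \<open>B\<close>. Thus \<open>C\<close>
    contains the unit ball and has positive measure.\<close>
  define \<rho> where "\<rho> = real n + 1"
  have \<rho>: "\<rho> > 0" by (simp add: \<rho>_def)
  define \<mu> where "\<mu> x = (\<integral>\<^sup>+z. indicator B z * indicator (ball 0 \<rho>) (z - x) \<partial>lborel)" for x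
  have [measurable]: "ball (0::'a) \<rho> \<in> sets borel" by simp
  have \<mu>: "\<mu> x = emeasure lborel (B \<inter> ball x \<rho>)" for x
  proof -
    have "\<mu> x = (\<integral>\<^sup>+z. indicator (B \<inter> ball x \<rho>) z \<partial>lborel)"
      unfolding \<mu>_def by (intro nn_integral_cong) (auto simp: dist_norm norm_minus_commute indicator_def)
    then show ?thesis by simp
  qed
  have [measurable]: "\<mu> \<in> borel_measurable borel"
    unfolding \<mu>_def[abs_def] by measurable
  define C where "C = {x. ennreal (b / 2) < \<mu> x}"
  have [measurable]: "C \<in> sets borel" unfolding C_def by measurable
  have sup: "ball 0 1 \<subseteq> C"
  proof
    fix x :: 'a assume x: "x \<in> ball 0 1"
    have "ball 0 (real n) \<subseteq> ball x \<rho>"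
    proof
      fix y :: 'a assume "y \<in> ball 0 (real n)"
      then show "y \<in> ball x \<rho>"
        using x norm_triangle_ineq4[of x y] by (simp add: \<rho>_def dist_norm)
    qed
    then have "emeasure lborel (B \<inter> ball 0 (real n)) \<le> \<mu> x"
      unfolding \<mu> by (intro emeasure_mono) auto
    with n show "x \<in> C" by (simp add: C_def)
  qed
  \<comment> \<open>Since 0 belongs to \<open>C\<close>, a point of \<open>C\<close> at norm at
    least 2\<rho> would give two disjoint balls, each with more than half of
    \<open>B\<close>.\<close>
  have sub: "C \<subseteq> ball 0 (2 * \<rho>)"
  proof
    fix x assume x: "x \<in> C"
    show "x \<in> ball 0 (2 * \<rho>)"
    proof (rule ccontr)
      assume "\<not> ?thesis"
      then have nx: "2 * \<rho> \<le> norm x" by simp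
      have disj: "(B \<inter> ball x \<rho>) \<inter> (B \<inter> ball 0 \<rho>) = {}"
      proof -
        have False if "dist x y < \<rho>" "norm y < \<rho>" for y
          using norm_triangle_sub[of x y] that nx by (simp add: dist_norm)
        then show ?thesis by auto
      qed
      have "0 \<in> C" using sup by (auto intro: subsetD)
      then have "ennreal (b / 2) + ennreal (b / 2) < \<mu> x + \<mu> 0"
        using x by (intro add_strict_mono) (auto simp: C_def)
      also have "\<dots> = emeasure lborel ((B \<inter> ball x \<rho>) \<union> (B \<inter> ball 0 \<rho>))"
        unfolding \<mu> by (rule plus_emeasure) (use disj in auto)
      also have "\<dots> \<le> emeasure lborel B" by (intro emeasure_mono) auto
      also have "\<dots> = ennreal (b / 2) + ennreal (b / 2)"
        using b by (simp flip: ennreal_plus)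
      finally show False by simp
    qed
  qed
  have finC: "emeasure lborel C < \<infinity>"
    using emeasure_mono[OF sub, of lborel] emeasure_lborel_ball_finite[of "0::'a" "2 * \<rho>"] by (auto intro: le_less_trans)
  have "0 < emeasure lborel (ball (0::'a) 1)" using emeasure_ball_less[of 0 1 "0::'a" 0] by simp
  also have "\<dots> \<le> emeasure lborel C" using sup by (intro emeasure_mono) auto
  finally have posC: "0 < measure lborel C"
    using finC by (simp add: measure_def enn2real_positive_iff)
  have intC: "integrable lborel (\<lambda>x. indicator C x *\<^sub>R x)"
    by (rule integrableI_bounded_set_indicator[where B="2 * \<rho>"])
      (use finC sub in \<open>auto intro!: AE_I2 simp: subset_iff less_imp_le\<close>)
  have intC1: "integrable lborel (\<lambda>x. indicator C x :: real)"
    using finC by (intro integrable_real_indicator) auto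
  define c where "c = (LINT x|lborel. indicator C x *\<^sub>R x) /\<^sub>R measure lborel C"
  show thesis
  proof (rule that[of c])
    fix v :: 'a and t
    assume v: "v \<noteq> 0" and null: "emeasure lborel {x. x \<bullet> v < t \<and> x \<in> B \<and> hreflect v t x \<notin> B} = 0"
    let ?h = "hreflect v t" and ?N = "{x. x \<bullet> v < t \<and> x \<in> B \<and> hreflect v t x \<notin> B}"
    have "?N \<in> sets borel" by measurable
    with null have N: "AE x in lborel. x \<notin> ?N" by (intro AE_not_in) auto
    have fixpt: "?h z = z" if "z \<bullet> v = t" for z using that by (simp add: hreflect_def)
    \<comment> \<open>Compare the points \<open>z\<close> and \<open>?h z\<close>: up to a null set
      \<open>B\<close> contains the image of each of its points on the side
      \<open>z \<bullet> v < t\<close>, and the ball around \<open>?h x\<close> favours the other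
      side.\<close>
    have less: "\<mu> x \<le> \<mu> (?h x)" if x: "x \<bullet> v < t" for x
    proof -
      define \<beta> :: "'a \<Rightarrow> ennreal" where "\<beta> z = indicator (ball 0 \<rho>) (z - x)" for z
      have [measurable]: "\<beta> \<in> borel_measurable borel" unfolding \<beta>_def[abs_def] by measurable
      have \<beta>': "indicator (ball 0 \<rho>) (z - ?h x) = \<beta> (?h z)" for z
        using norm_diff_hreflect[of z v t x] by (simp add: \<beta>_def indicator_def)
      have "2 * \<mu> x = (\<integral>\<^sup>+z. indicator B z * \<beta> z + indicator B (?h z) * \<beta> (?h z) \<partial>lborel)"
        unfolding \<mu>_def \<beta>_def[symmetric] by (rule nn_integral_add_hreflect[symmetric]) measurable
      also have "\<dots> \<le> (\<integral>\<^sup>+z. indicator B z * \<beta> (?h z) + indicator B (?h z) * \<beta> z \<partial>lborel)"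
      proof (rule nn_integral_mono_AE)
        show "AE z in lborel. indicator B z * \<beta> z + indicator B (?h z) * \<beta> (?h z)
            \<le> indicator B z * \<beta> (?h z) + indicator B (?h z) * \<beta> z"
          using N AE_hreflect[OF N, of v t]
        proof eventually_elim
          case (elim z)
          have 1: "\<beta> (?h z) \<le> \<beta> z" if "z \<bullet> v < t"
            using norm_le_hreflect[OF v, of z t x] x that
            by (auto simp: \<beta>_def indicator_def norm_minus_commute mult_nonpos_nonpos)
          have 2: "\<beta> z \<le> \<beta> (?h z)" if "\<not> z \<bullet> v < t"
            using norm_ge_hreflect[OF v, of z t x] x that
            by (auto simp: \<beta>_def indicator_def norm_minus_commute mult_nonneg_nonpos)
          have 3: "z \<in> B \<Longrightarrow> ?h z \<in> B" if "z \<bullet> v < t" using elim(1) that by simp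
          have 4: "?h z \<in> B \<Longrightarrow> z \<in> B" if "\<not> z \<bullet> v < t"
            using elim(2) that fixpt[of z] by (cases "z \<bullet> v = t") (auto simp: hreflect_inner[OF v])
          show ?case
            using 1 2 3 4 by (cases "z \<bullet> v < t"; cases "z \<in> B"; cases "?h z \<in> B") (simp_all add: add.commute)
        qed
      qed
      also have "\<dots> = 2 * \<mu> (?h x)"
      proof -
        have "(\<integral>\<^sup>+z. indicator B z * \<beta> (?h z) + indicator B (?h z) * \<beta> (?h (?h z)) \<partial>lborel)
            = 2 * (\<integral>\<^sup>+z. indicator B z * \<beta> (?h z) \<partial>lborel)"
          by (rule nn_integral_add_hreflect) measurable
        then show ?thesis by (simp add: \<mu>_def \<beta>')
      qed
      finally show ?thesis by (subst (asm) ennreal_mult_le_mult_iff) auto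
    qed
    \<comment> \<open>The claim says that the integral of \<open>f\<close> is nonnegative.
      Reflection changes the sign of \<open>x \<bullet> v - t\<close>, so
      \<open>f x + f (?h x)\<close> is a product of two factors, and \<open>less\<close> shows that
      their signs agree.\<close>
    define f :: "'a \<Rightarrow> real" where "f x = indicator C x * (x \<bullet> v - t)" for x
    have f_eq: "f x = (indicator C x *\<^sub>R x) \<bullet> v - indicator C x * t" for x
      by (simp add: f_def right_diff_distrib)
    have int_f: "integrable lborel f"
      unfolding f_eq[abs_def] using intC intC1 by (intro Bochner_Integration.integrable_diff integrable_inner_left integrable_mult_left) auto
    have int_fh: "integrable lborel (\<lambda>x. f (?h x))" "(LINT x|lborel. f (?h x)) = (LINT x|lborel. f x)"
    proof -
      have [measurable]: "f \<in> borel_measurable borel" unfolding f_def[abs_def] by measurable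
      have "integrable (distr lborel borel ?h) f" using int_f by (simp add: distr_lborel_hreflect)
      then show "integrable lborel (\<lambda>x. f (?h x))" by (subst (asm) integrable_distr_eq) auto
      show "(LINT x|lborel. f (?h x)) = (LINT x|lborel. f x)"
        using integral_distr[of ?h lborel borel f] by (simp add: distr_lborel_hreflect)
    qed
    have "0 \<le> (LINT x|lborel. f x + f (?h x))"
    proof (rule Bochner_Integration.integral_nonneg)
      fix x
      have 1: "?h x \<in> C" if "x \<bullet> v < t" "x \<in> C" using less[OF that(1)] that(2) by (auto simp: C_def)
      have 2: "x \<in> C" if "x \<bullet> v > t" "?h x \<in> C"
        using less[of "?h x"] that by (auto simp: C_def hreflect_inner[OF v])
      have "f x + f (?h x) = (indicator C x - indicator C (?h x)) * (x \<bullet> v - t)"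
        by (simp add: f_def hreflect_inner[OF v] algebra_simps)
      also have "0 \<le> \<dots>"
      proof (cases "x \<bullet> v < t")
        case True
        with 1 show ?thesis by (intro mult_nonpos_nonpos) (auto simp: indicator_def)
      next
        case False
        with 2 show ?thesis
          by (cases "x \<bullet> v = t") (auto intro!: mult_nonneg_nonneg simp: indicator_def)
      qed
      finally show "0 \<le> f x + f (?h x)" .
    qed
    also have "\<dots> = 2 * (LINT x|lborel. f x)"
      using int_f int_fh by simp
    also have "(LINT x|lborel. f x) = (LINT x|lborel. indicator C x *\<^sub>R x) \<bullet> v - measure lborel C * t"
    proof -
      have "integrable lborel (\<lambda>x. (indicator C x *\<^sub>R x) \<bullet> v)" "integrable lborel (\<lambda>x. indicator C x * t)"
        using intC intC1 by (intro integrable_inner_left integrable_mult_left; simp)+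
      moreover have "(LINT x|lborel. (indicator C x *\<^sub>R x) \<bullet> v) = (LINT x|lborel. indicator C x *\<^sub>R x) \<bullet> v"
        using intC by (intro integral_inner_left) auto
      moreover have "(LINT x|lborel. indicator C x * t) = measure lborel C * t"
        by simp
      ultimately show ?thesis
        unfolding f_eq by (simp only: Bochner_Integration.integral_diff)
    qed
    finally have "measure lborel C * t \<le> (LINT x|lborel. indicator C x *\<^sub>R x) \<bullet> v" by simp
    then show "t \<le> c \<bullet> v"
      using posC by (simp add: c_def field_simps)
  qed
qed

text \<open>If the difference had positive measure, some reflection would carry a positive amount of
  \<open>A - ball c a\<close> into \<open>ball c a - A\<close>. Oriented with \<open>c\<close> on
  the favoured side, its hyperplane violates the polarization hypothesis.\<close>

lemma polarized_eq_ball: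
  fixes A :: "'a::euclidean_space set"
  assumes [measurable]: "A \<in> sets borel" and eq: "emeasure lborel A = emeasure lborel (ball c a)"
    and pol: "\<And>v t. v \<noteq> 0 \<Longrightarrow> c \<bullet> v < t \<Longrightarrow>
      emeasure lborel {x. x \<bullet> v < t \<and> x \<notin> A \<and> hreflect v t x \<in> A} = 0"
  shows "sym_diff A (ball c a) \<in> null_sets lborel"
proof -
  let ?b = "ball c a"
  have PQ: "emeasure lborel (A - ?b) = emeasure lborel (?b - A)"
    by (rule emeasure_Diff_eq) (simp_all add: eq)
  have "emeasure lborel (A - ?b) = 0"
  proof (rule ccontr)
    assume nz: "emeasure lborel (A - ?b) \<noteq> 0"
    have "emeasure lborel (A - ?b) = (SUP n. emeasure lborel ((A - ?b) \<inter> ball 0 (real n)))"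
      by (rule emeasure_SUP_Int_ball) simp
    with nz have "0 < (SUP n. emeasure lborel ((A - ?b) \<inter> ball 0 (real n)))"
      by (simp add: zero_less_iff_neq_zero)
    then obtain n where n: "0 < emeasure lborel ((A - ?b) \<inter> ball 0 (real n))"
      unfolding less_SUP_iff by blast
    \<comment> \<open>Large enough for \<open>ball 0 R\<close> to contain \<open>ball c a\<close>,
      and to leave positive mass in the truncation \<open>P\<close> of the possibly unbounded set
      \<open>A - ball c a\<close>.\<close>
    define R where "R = max (real n) (norm c + \<bar>a\<bar>) + 1"
    define P where "P = (A - ?b) \<inter> ball 0 R"
    have [measurable]: "P \<in> sets borel" by (simp add: P_def)
    have R: "R > 0" by (simp add: R_def)
    have "0 < emeasure lborel P"
      using n by (rule less_le_trans) (auto simp: P_def R_def intro!: emeasure_mono)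
    moreover have "emeasure lborel (?b - A) \<noteq> \<infinity>"
      using emeasure_mono[of "?b - A" ?b lborel] emeasure_ball_neq_top[of c a] by (auto simp: top_unique)
    moreover have "emeasure lborel P \<le> emeasure lborel (?b - A)"
      unfolding PQ[symmetric] P_def by (intro emeasure_mono) auto
    ultimately obtain m where m: "m > 0" "emeasure lborel P = ennreal m"
      by (cases "emeasure lborel P") (auto simp: top_unique)
    have sub: "?b - A \<subseteq> ball 0 R"
    proof
      fix y assume "y \<in> ?b - A"
      then show "y \<in> ball 0 R"
        using norm_triangle_sub[of y c] by (auto simp: R_def dist_norm norm_minus_commute)
    qed
    show False
    proof (rule hreflect_overlap_exists[OF R m(1), where 'a='a])
      fix e :: real
      assume e: "e > 0" and ov: "\<And>P Q. P \<in> sets borel \<Longrightarrow> Q \<in> sets borel \<Longrightarrow>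
          P \<subseteq> ball (0 :: 'a) R \<Longrightarrow> Q \<subseteq> ball 0 R \<Longrightarrow>
          ennreal m \<le> emeasure lborel P \<Longrightarrow> ennreal m \<le> emeasure lborel Q \<Longrightarrow>
          \<exists>v t. ennreal e \<le> emeasure lborel (P \<inter> hreflect v t -` Q)"
      have "\<exists>v t. ennreal e \<le> emeasure lborel (P \<inter> hreflect v t -` (?b - A))"
        using sub m \<open>emeasure lborel P \<le> emeasure lborel (?b - A)\<close> by (intro ov) (auto simp: P_def)
      then obtain v t where le: "ennreal e \<le> emeasure lborel (P \<inter> hreflect v t -` (?b - A))" by blast
      have "P \<inter> hreflect v t -` (?b - A) \<noteq> {}"
      proof
        assume "P \<inter> hreflect v t -` (?b - A) = {}"
        with le e show False by simp
      qed
      then obtain x where "x \<in> P" "hreflect v t x \<in> ?b - A" by blast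
      then have "norm (hreflect v t x - c) < norm (x - c)"
        by (auto simp: P_def dist_norm norm_minus_commute)
      then obtain w s where w: "w \<noteq> 0" "c \<bullet> w < s" "hreflect w s = hreflect v t"
        by (rule hreflect_closer)
      \<comment> \<open>The overlap consists of points farther from \<open>c\<close> than their
        images. Its reflection has the same measure and lies on the favoured side.\<close>
      have "ennreal e \<le> emeasure lborel (hreflect w s -` (P \<inter> hreflect w s -` (?b - A)))"
        using le unfolding w(3) by (subst emeasure_vimage_hreflect) auto
      also have "\<dots> \<le> emeasure lborel {x. x \<bullet> w < s \<and> x \<notin> A \<and> hreflect w s x \<in> A}"
      proof (rule emeasure_mono)
        show "hreflect w s -` (P \<inter> hreflect w s -` (?b - A)) \<subseteq> {x. x \<bullet> w < s \<and> x \<notin> A \<and> hreflect w s x \<in> A}"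
        proof
          fix z assume "z \<in> hreflect w s -` (P \<inter> hreflect w s -` (?b - A))"
          then have z: "hreflect w s z \<in> A" "\<not> dist c (hreflect w s z) < a" "dist c z < a" "z \<notin> A"
            by (auto simp: P_def)
          then have "norm (c - z) < norm (c - hreflect w s z)" by (simp add: dist_norm)
          then have "(z \<bullet> w - s) * (c \<bullet> w - s) > 0"
            by (simp only: norm_less_hreflect_iff[OF w(1)])
          then have "z \<bullet> w < s" using w(2) by (simp add: zero_less_mult_iff)
          with z show "z \<in> {x. x \<bullet> w < s \<and> x \<notin> A \<and> hreflect w s x \<in> A}" by simp
        qed
      qed measurable
      also have "\<dots> = 0" by (rule pol[OF w(1,2)])
      finally show False using e by simp
    qed
  qed
  with PQ show ?thesis
    by (intro null_sets.Un) (auto simp: null_sets_def)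
qed

context radial_kernel
begin

theorem interaction_eq_ballsD:
  assumes [measurable]: "A \<in> sets borel" "B \<in> sets borel" and ab: "0 < a" "0 < b"
    and A: "emeasure lborel A = emeasure lborel (ball (0 :: 'a) a)"
    and B: "emeasure lborel B = emeasure lborel (ball (0 :: 'a) b)"
    and eq: "interaction k A B = interaction k (ball 0 a) (ball 0 b)"
  shows "\<exists>c. sym_diff A (ball c a) \<in> null_sets lborel \<and> sym_diff B (ball c b) \<in> null_sets lborel"
proof -
  have pol: "emeasure lborel {x. x \<bullet> v < t \<and> x \<in> A \<and> hreflect v t x \<notin> A} = 0 \<or>
         emeasure lborel {x. x \<bullet> v < t \<and> x \<notin> B \<and> hreflect v t x \<in> B} = 0"
    "emeasure lborel {x. x \<bullet> v < t \<and> x \<in> B \<and> hreflect v t x \<notin> B} = 0 \<or>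
         emeasure lborel {x. x \<bullet> v < t \<and> x \<notin> A \<and> hreflect v t x \<in> A} = 0" if v: "v \<noteq> 0" for v t
  proof -
    \<comment> \<open>The polarized sets have the same volumes, so Riesz' inequality bounds their
      interaction by that of the balls, which by assumption is the original one. Exchanging
      \<open>A\<close> and \<open>B\<close> then covers the opposite preference.\<close>
    have "interaction k (polarize v t A) (polarize v t B) \<le> interaction k A B"
      unfolding eq using ab v by (intro interaction_le_balls) (auto simp: emeasure_polarize A B)
    with interaction_polarize[of A B v t] v
    have eq': "interaction k (polarize v t A) (polarize v t B) = interaction k A B" by (auto intro: antisym)
    then show "emeasure lborel {x. x \<bullet> v < t \<and> x \<in> A \<and> hreflect v t x \<notin> A} = 0 \<or>
         emeasure lborel {x. x \<bullet> v < t \<and> x \<notin> B \<and> hreflect v t x \<in> B} = 0"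
      by (intro interaction_polarize_eq v) (simp_all add: A)
    from eq' have "interaction k (polarize v t B) (polarize v t A) = interaction k B A"
      by (simp add: interaction_commute)
    then show "emeasure lborel {x. x \<bullet> v < t \<and> x \<in> B \<and> hreflect v t x \<notin> B} = 0 \<or>
         emeasure lborel {x. x \<bullet> v < t \<and> x \<notin> A \<and> hreflect v t x \<in> A} = 0"
      by (intro interaction_polarize_eq v) (simp_all add: B)
  qed
  have pos: "emeasure lborel (ball (0::'a) r) \<noteq> 0" if "r > 0" for r
    using emeasure_ball_less[of 0 r "0::'a" 0] that by simp
  have ball_c: "emeasure lborel (ball c r) = emeasure lborel (ball (0::'a) r)" if "r > 0" for c :: 'a and r
    using that by (simp add: emeasure_ball)
  obtain c where c: "\<And>v t. v \<noteq> 0 \<Longrightarrow>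
      emeasure lborel {x. x \<bullet> v < t \<and> x \<in> B \<and> hreflect v t x \<notin> B} = 0 \<Longrightarrow> t \<le> c \<bullet> v"
    by (rule center_exists[of B]) (use pos ab B in auto)
  obtain c' where c': "\<And>v t. v \<noteq> 0 \<Longrightarrow>
      emeasure lborel {x. x \<bullet> v < t \<and> x \<in> A \<and> hreflect v t x \<notin> A} = 0 \<Longrightarrow> t \<le> c' \<bullet> v"
    by (rule center_exists[of A]) (use pos ab A in auto)
  have A_ball: "sym_diff A (ball c a) \<in> null_sets lborel"
  proof (rule polarized_eq_ball)
    fix v :: 'a and t assume "v \<noteq> 0" "c \<bullet> v < t"
    then show "emeasure lborel {x. x \<bullet> v < t \<and> x \<notin> A \<and> hreflect v t x \<in> A} = 0"
      using pol(2)[of v t] c[of v t] by (meson not_le)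
  qed (simp_all only: A ball_c[OF ab(1), of c] assms(1))
  have B_ball: "sym_diff B (ball c' b) \<in> null_sets lborel"
  proof (rule polarized_eq_ball)
    fix v :: 'a and t assume "v \<noteq> 0" "c' \<bullet> v < t"
    then show "emeasure lborel {x. x \<bullet> v < t \<and> x \<notin> B \<and> hreflect v t x \<in> B} = 0"
      using pol(1)[of v t] c'[of v t] by (meson not_le)
  qed (simp_all only: B ball_c[OF ab(2), of c'] assms(2))
  have "c' = c"
  proof (rule ccontr)
    assume "c' \<noteq> c"
    \<comment> \<open>The hyperplane through \<open>c\<close> orthogonal to \<open>c - c'\<close>:
      up to a null set \<open>A\<close> is a ball around \<open>c\<close> and hence symmetric in it,
      so the property of \<open>c'\<close> gives c \<bullet> v \<le> c' \<bullet> v, which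
      contradicts \<open>v \<noteq> 0\<close>.\<close>
    define v where "v = c - c'"
    define t where "t = c \<bullet> v"
    have v: "v \<noteq> 0" using \<open>c' \<noteq> c\<close> by (simp add: v_def)
    let ?N = "sym_diff A (ball c a)"
    have [measurable]: "?N \<in> sets borel" by measurable
    have hc: "hreflect v t c = c" by (simp add: hreflect_def t_def)
    have "dist c (hreflect v t x) = dist c x" for x
      using norm_hreflect_hreflect[of v t c x] by (simp add: hc dist_norm)
    then have "{x. x \<bullet> v < t \<and> x \<in> A \<and> hreflect v t x \<notin> A} \<subseteq> ?N \<union> hreflect v t -` ?N"
      by auto
    moreover have "?N \<union> hreflect v t -` ?N \<in> null_sets lborel"
    proof (rule null_sets.Un[OF A_ball])
      have "emeasure lborel (hreflect v t -` ?N) = 0"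
        using A_ball emeasure_vimage_hreflect[OF \<open>?N \<in> sets borel\<close>, of v t] by (simp only: null_setsD1)
      moreover have "hreflect v t -` ?N \<in> sets borel" by measurable
      ultimately show "hreflect v t -` ?N \<in> null_sets lborel" by (intro null_setsI) (simp_all only: sets_lborel)
    qed
    ultimately have "{x. x \<bullet> v < t \<and> x \<in> A \<and> hreflect v t x \<notin> A} \<in> null_sets lborel"
      by (rule null_sets_subset[rotated 2]) measurable
    then have "t \<le> c' \<bullet> v" using v by (intro c') auto
    then have "v \<bullet> v \<le> 0" by (simp add: t_def v_def inner_diff_left)
    with v show False by (metis inner_gt_zero_iff not_le)
  qed
  with A_ball B_ball show ?thesis by blast
qed

end

section \<open>Rearrangement of slices\<close>

lemma ball_rearrangement_infinite: "emeasure lebesgue A = \<infinity> \<Longrightarrow> ball_rearrangement A = UNIV"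
  by (simp add: ball_rearrangement_def)

lemma ball_rearrangement_finite:
  assumes "emeasure lebesgue A \<noteq> \<infinity>"
  obtains r where "0 \<le> r" "ball_rearrangement A = ball 0 r"
    "emeasure lborel (ball (0 :: real^'m) r) = emeasure lebesgue (A :: (real^'m) set)"
proof -
  let ?r = "THE r. 0 \<le> r \<and> emeasure lebesgue (ball (0 :: real^'m) r) = emeasure lebesgue A"
  have "0 \<le> ?r \<and> emeasure lebesgue (ball (0 :: real^'m) ?r) = emeasure lebesgue A"
    by (rule theI'[OF ball_radius_ex1[OF assms]])
  moreover have "ball_rearrangement A = ball 0 ?r"
    using assms by (simp add: ball_rearrangement_def)
  ultimately show ?thesis using that[of ?r] by simp
qed

text \<open>Volumes replace the radius, which is given by a definite description, so that the
  dependence on the section becomes visibly measurable. The strict inequality corresponds to open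
  balls.\<close>

lemma mem_ball_rearrangement_iff:
  "x \<in> ball_rearrangement A \<longleftrightarrow>
    emeasure lebesgue A = \<infinity> \<or> emeasure lborel (ball (0 :: real^'m) (norm x)) < emeasure lebesgue (A :: (real^'m) set)"
proof (cases "emeasure lebesgue A = \<infinity>")
  case False
  then obtain r where r: "0 \<le> r" "ball_rearrangement A = ball 0 r"
    "emeasure lborel (ball (0 :: real^'m) r) = emeasure lebesgue A"
    by (rule ball_rearrangement_finite)
  have "x \<in> ball_rearrangement A \<longleftrightarrow> \<not> r \<le> norm x" by (auto simp: r(2))
  also have "\<dots> \<longleftrightarrow> \<not> emeasure lborel (ball (0 :: real^'m) r) \<le> emeasure lborel (ball (0 :: real^'m) (norm x))"
    using r(1) by (simp only: emeasure_ball_le_iff norm_ge_zero)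
  finally show ?thesis using False unfolding r(3) by (simp add: not_le)
qed (simp add: ball_rearrangement_infinite)

lemma ball_rearrangement_borel [measurable]: "ball_rearrangement A \<in> sets borel"
proof (cases "emeasure lebesgue A = \<infinity>")
  case False
  then show ?thesis by (rule ball_rearrangement_finite) auto
qed (simp add: ball_rearrangement_infinite)

text \<open>Subtracting the closed ball leaves an open null set, which is empty; so one ball lies in
  the closure of the other, and equal radii force equal centres.\<close>

lemma ball_center_unique:
  fixes c c' :: "'a::euclidean_space"
  assumes "sym_diff A (ball c a) \<in> null_sets lborel" "sym_diff A (ball c' a) \<in> null_sets lborel"
    and a: "a > 0"
  shows "c = c'"
proof -
  have "sym_diff A (ball c a) \<union> sym_diff A (ball c' a) \<in> null_sets lborel"
    by (rule null_sets.Un[OF assms(1,2)])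
  then have "ball c a - cball c' a \<in> null_sets lborel"
    by (rule null_sets_subset) (auto simp: dist_commute)
  then have "negligible (ball c a - cball c' a)"
    by (simp add: negligible_iff_null_sets null_sets_completionI)
  moreover have "open (ball c a - cball c' a)" by (intro open_Diff) auto
  ultimately have "ball c a \<subseteq> cball c' a" using open_not_negligible by blast
  then have "dist c c' + a \<le> a \<or> a \<le> 0" by (simp add: ball_subset_cball_iff)
  with a show ?thesis by simp
qed

context radial_kernel
begin

lemma interaction_add_Compl:
  assumes [measurable]: "A \<in> sets borel" "B \<in> sets borel"
  shows "interaction k A B + interaction k A (- B) = emeasure lborel A * (\<integral>\<^sup>+x. k x \<partial>lborel)"
proof -
  have "interaction k A B + interaction k A (- B)
      = (\<integral>\<^sup>+x. \<integral>\<^sup>+y. indicator A x * indicator B y * k (x - y) + indicator A x * indicator (- B) y * k (x - y) \<partial>lborel \<partial>lborel)"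
    unfolding interaction_def by (simp add: nn_integral_add)
  also have "\<dots> = (\<integral>\<^sup>+x. indicator A x * (\<integral>\<^sup>+y. k (x - y) \<partial>lborel) \<partial>lborel)"
    by (subst nn_integral_cmult[symmetric]) (auto intro!: nn_integral_cong simp: indicator_def)
  also have "\<dots> = emeasure lborel A * (\<integral>\<^sup>+x. k x \<partial>lborel)"
    by (simp add: nn_integral_lborel_reflect nn_integral_multc)
  finally show ?thesis .
qed

lemma k_pos: "0 < k x"
proof -
  obtain u :: 'a where u: "norm u = norm x + 1"
    using vector_choose_size[of "norm x + 1"] by auto
  have "0 \<le> k u" by simp
  also have "k u < k x" by (rule decr) (simp add: u)
  finally show ?thesis .
qed

lemma interaction_eq_0D:
  assumes [measurable]: "A \<in> sets borel" "B \<in> sets borel" and A: "emeasure lborel A \<noteq> 0"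
    and eq: "interaction k A B = 0"
  shows "B \<in> null_sets lborel"
proof -
  have "AE x in lborel. (\<integral>\<^sup>+y. indicator A x * indicator B y * k (x - y) \<partial>lborel) = 0"
    using eq unfolding interaction_def by (subst (asm) nn_integral_0_iff_AE) auto
  from AE_positive_measure_ex[OF this A] obtain x
    where x: "x \<in> A" "(\<integral>\<^sup>+y. indicator A x * indicator B y * k (x - y) \<partial>lborel) = 0" by auto
  have "AE y in lborel. indicator A x * indicator B y * k (x - y) = 0"
    using x(2) by (subst (asm) nn_integral_0_iff_AE) auto
  then have "AE y in lborel. y \<notin> B"
  proof eventually_elim
    case (elim y)
    then show ?case using x(1) k_pos[of "x - y"] by (auto simp: indicator_def split: if_splits)
  qed
  then show ?thesis by (simp add: AE_iff_null_sets)
qed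

end

locale radial_kernel_cart = radial_kernel k for k :: "real^'m \<Rightarrow> ennreal"
begin

text \<open>By \<open>interaction_add_Compl\<close> the interactions with \<open>B\<close> and
  \<open>- B\<close> have a sum that depends only on the volume of \<open>A\<close>. This sum is
  finite, so cancellation reverses Riesz' inequality. For infinite \<open>B\<close> the rearranged
  complement is empty.\<close>

lemma interaction_ball_rearrangement:
  assumes [measurable]: "A \<in> sets borel" "B \<in> sets borel" and A: "emeasure lborel A \<noteq> \<infinity>"
  shows "interaction k (ball_rearrangement A) (- ball_rearrangement B) \<le> interaction k A (- B)"
    and "interaction k (ball_rearrangement A) (- ball_rearrangement B) = interaction k A (- B) \<Longrightarrow>
      emeasure lborel B \<noteq> \<infinity> \<Longrightarrow>
      interaction k A B = interaction k (ball_rearrangement A) (ball_rearrangement B)"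
proof -
  let ?A = "ball_rearrangement A" and ?B = "ball_rearrangement B"
  have A': "emeasure lebesgue A \<noteq> \<infinity>" using A by simp
  obtain a where a: "0 \<le> a" "?A = ball 0 a" "emeasure lborel (ball (0 :: real^'m) a) = emeasure lborel A"
    using ball_rearrangement_finite[OF A'] by auto
  have fin: "emeasure lborel A * (\<integral>\<^sup>+x. k x \<partial>lborel) \<noteq> \<infinity>"
    using A integral_finite by (simp add: ennreal_mult_eq_top_iff)
  have sum: "interaction k ?A ?B + interaction k ?A (- ?B) = interaction k A B + interaction k A (- B)"
    by (simp add: interaction_add_Compl a)
  have finA: "interaction k A B \<noteq> \<infinity>" "interaction k A (- B) \<noteq> \<infinity>" "interaction k ?A (- ?B) \<noteq> \<infinity>"
    using fin interaction_le[of A B] interaction_le[of A "- B"] interaction_le[of ?A "- ?B"]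
    by (auto simp: a top_unique)
  have le: "interaction k A B \<le> interaction k ?A ?B" if "emeasure lborel B \<noteq> \<infinity>"
  proof -
    have B': "emeasure lebesgue B \<noteq> \<infinity>" using that by simp
    obtain b where b: "0 \<le> b" "?B = ball 0 b" "emeasure lborel (ball (0 :: real^'m) b) = emeasure lborel B"
      using ball_rearrangement_finite[OF B'] by auto
    show ?thesis unfolding a(2) b(2) by (rule interaction_le_balls) (use a b in auto)
  qed
  show "interaction k ?A (- ?B) \<le> interaction k A (- B)"
  proof (cases "emeasure lborel B = \<infinity>")
    case True
    then show ?thesis by (simp add: ball_rearrangement_infinite interaction_def)
  next
    case False
    have "interaction k A B + interaction k ?A (- ?B) \<le> interaction k A B + interaction k A (- B)"
      unfolding sum[symmetric] by (intro add_right_mono le False)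
    then show ?thesis using finA unfolding ennreal_add_left_cancel_le by simp
  qed
  assume "interaction k ?A (- ?B) = interaction k A (- B)"
  with sum have "interaction k A (- B) + interaction k ?A ?B = interaction k A (- B) + interaction k A B"
    by (simp add: add.commute)
  then show "interaction k A B = interaction k ?A ?B"
    using finA by (metis ennreal_add_left_cancel)
qed

text \<open>For infinite \<open>B\<close> the rearranged side vanishes, and positivity of the kernel
  forces \<open>- B\<close> to be null. The conclusion \<open>a > 0\<close> is recorded because the
  centre of an empty ball is undetermined.\<close>

lemma interaction_ball_rearrangement_eqD:
  assumes [measurable]: "A \<in> sets borel" "B \<in> sets borel"
    and A: "emeasure lborel A \<noteq> 0" "emeasure lborel A \<noteq> \<infinity>"
    and eq: "interaction k (ball_rearrangement A) (- ball_rearrangement B) = interaction k A (- B)"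
  shows "emeasure lborel B = \<infinity> \<Longrightarrow> - B \<in> null_sets lborel"
    and "emeasure lborel B \<noteq> 0 \<Longrightarrow> emeasure lborel B \<noteq> \<infinity> \<Longrightarrow>
      \<exists>c a b. a > 0 \<and> ball_rearrangement A = ball 0 a \<and> ball_rearrangement B = ball 0 b \<and>
        sym_diff A (ball c a) \<in> null_sets lborel \<and> sym_diff B (ball c b) \<in> null_sets lborel"
proof -
  assume "emeasure lborel B = \<infinity>"
  then have "interaction k A (- B) = 0"
    using eq by (simp add: ball_rearrangement_infinite interaction_def)
  then show "- B \<in> null_sets lborel" by (intro interaction_eq_0D[OF _ _ A(1)]) auto
next
  assume B: "emeasure lborel B \<noteq> 0" "emeasure lborel B \<noteq> \<infinity>"
  have fin: "emeasure lebesgue A \<noteq> \<infinity>" "emeasure lebesgue B \<noteq> \<infinity>" using A B by simp_all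
  obtain a where a: "0 \<le> a" "ball_rearrangement A = ball 0 a" "emeasure lborel (ball (0 :: real^'m) a) = emeasure lborel A"
    using ball_rearrangement_finite[OF fin(1)] by auto
  obtain b where b: "0 \<le> b" "ball_rearrangement B = ball 0 b" "emeasure lborel (ball (0 :: real^'m) b) = emeasure lborel B"
    using ball_rearrangement_finite[OF fin(2)] by auto
  have "a \<noteq> 0" "b \<noteq> 0" using a(3) b(3) A B by auto
  then have "a > 0" "b > 0" using a b by auto
  moreover have "interaction k A B = interaction k (ball 0 a) (ball 0 b)"
    using interaction_ball_rearrangement(2)[OF assms(1,2) A(2) eq B(2)] by (simp add: a b)
  ultimately have "\<exists>c. sym_diff A (ball c a) \<in> null_sets lborel \<and> sym_diff B (ball c b) \<in> null_sets lborel"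
    by (intro interaction_eq_ballsD) (simp_all add: a b)
  with \<open>a > 0\<close> a b show "\<exists>c a b. a > 0 \<and> ball_rearrangement A = ball 0 a \<and> ball_rearrangement B = ball 0 b \<and>
        sym_diff A (ball c a) \<in> null_sets lborel \<and> sym_diff B (ball c b) \<in> null_sets lborel"
    by blast
qed

end

text \<open>The value at the origin is irrelevant for the integrals and is put to \<open>\<infinity>\<close>, since the kernel is only
  assumed to be monotone away from the origin.\<close>

definition kernel_section :: "(real \<times> (real^'m) \<Rightarrow> real) \<Rightarrow> real \<Rightarrow> real^'m \<Rightarrow> ennreal" where
  "kernel_section K s z = (if z = 0 then \<infinity> else ennreal (K (s, z)))"

text \<open>Orthogonal maps act transitively on spheres, so invariance makes the section a function
  of the norm. At the origin the value \<infinity> exceeds the finite values elsewhere.\<close>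

lemma radial_kernel_section:
  fixes K :: "real \<times> (real^'m) \<Rightarrow> real"
  assumes K_pos: "\<forall>x. 0 < K x"
    and K_inv: "\<forall>x1 x' (R :: real^'m^'m). orthogonal_matrix R \<longrightarrow> K (x1, R *v x') = K (x1, x')"
    and K_decr: "\<forall>x1 x' y'. 0 < norm x' \<and> norm x' < norm y' \<longrightarrow> K (x1, y') < K (x1, x')"
    and K_int: "integrable lebesgue (\<lambda>x'. K (s, x'))"
  shows "radial_kernel_cart (kernel_section K s)"
proof
  fix x y :: "real^'m"
  show "kernel_section K s y < kernel_section K s x" if "norm x < norm y"
    using that K_pos K_decr[rule_format, of x y s] norm_ge_zero[of x]
    by (auto simp: kernel_section_def ennreal_less_iff less_imp_le)
  show "kernel_section K s x = kernel_section K s y" if "norm x = norm y"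
  proof -
    obtain f :: "real^'m \<Rightarrow> real^'m" where f: "orthogonal_transformation f" "f x = y"
      using orthogonal_transformation_exists[OF \<open>norm x = norm y\<close>] by blast
    then have "orthogonal_matrix (matrix f)" "matrix f *v x = y"
      by (auto simp: orthogonal_transformation_matrix matrix_works)
    then have "K (s, y) = K (s, x)" using K_inv by metis
    with that show ?thesis by (auto simp: kernel_section_def)
  qed
next
  have "AE x in lborel. kernel_section K s x = ennreal (K (s, x))"
    using AE_lborel_singleton[of "0 :: real^'m"] by eventually_elim (simp add: kernel_section_def)
  then have "(\<integral>\<^sup>+x. kernel_section K s x \<partial>lborel) = (\<integral>\<^sup>+x. ennreal (K (s, x)) \<partial>lborel)"
    by (rule nn_integral_cong_AE)
  also have "\<dots> = (\<integral>\<^sup>+x. ennreal (norm (K (s, x))) \<partial>lebesgue)"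
    using K_pos by (simp add: nn_integral_completion less_imp_le)
  also have "\<dots> < \<infinity>" using K_int by (simp add: integrable_iff_bounded)
  finally show "(\<integral>\<^sup>+x. kernel_section K s x \<partial>lborel) \<noteq> \<infinity>" by simp
qed

section \<open>Integration over the slices\<close>

lemma AE_lborel_affine:
  fixes t :: "'a::euclidean_space"
  assumes "AE x in lborel. P x" and c: "c \<noteq> 0"
  shows "AE x in lborel. P (t + c *\<^sub>R x)"
proof -
  obtain N where N: "{x. \<not> P x} \<subseteq> N" and [measurable]: "N \<in> sets borel" and null: "emeasure lborel N = 0"
    using assms by (auto elim!: AE_E)
  have "ennreal (\<bar>c\<bar> ^ DIM('a)) * (\<integral>\<^sup>+x. indicator N (t + c *\<^sub>R x) \<partial>lborel) = 0"
    by (subst nn_integral_lborel_affine[OF _ c]) (auto simp: null)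
  then have "(\<integral>\<^sup>+x. indicator N (t + c *\<^sub>R x) \<partial>lborel) = 0"
    using c by simp
  then have "AE x in lborel. indicator N (t + c *\<^sub>R x) = (0 :: ennreal)"
    by (subst (asm) nn_integral_0_iff_AE) auto
  then show ?thesis
    by eventually_elim (use N in \<open>auto simp: indicator_def split: if_splits\<close>)
qed

lemma AE_lborel_shift:
  fixes t :: "'a::euclidean_space"
  assumes "AE x in lborel. P x"
  shows "AE x in lborel. P (x + t)"
  using AE_lborel_affine[OF assms, of 1 t] by (simp add: add.commute)

lemma AE_lborel_reflect:
  fixes t :: "'a::euclidean_space"
  assumes "AE x in lborel. P x"
  shows "AE x in lborel. P (t - x)"
  using AE_lborel_affine[OF assms, of "-1" t] by simp

lemma nn_integral_lborel_pair:
  fixes f :: "'a::euclidean_space \<times> 'b::euclidean_space \<Rightarrow> ennreal"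
  assumes "f \<in> borel_measurable borel"
  shows "(\<integral>\<^sup>+z. f z \<partial>lborel) = (\<integral>\<^sup>+x. \<integral>\<^sup>+y. f (x, y) \<partial>lborel \<partial>lborel)"
  using lborel.nn_integral_fst[of f lborel] assms by (simp add: lborel_prod)

lemma AE_lborel_pairD:
  assumes "AE z in (lborel :: ('a::euclidean_space \<times> 'b::euclidean_space) measure). P z"
  shows "AE x in lborel. AE y in lborel. P (x, y)"
  using assms unfolding lborel_prod[symmetric] by (rule lborel_pair.AE_pair)

lemma AE_lborel_pairI:
  assumes "{z. P z} \<in> sets (borel :: ('a::euclidean_space \<times> 'b::euclidean_space) measure)"
    and "AE x in lborel. AE y in lborel. P (x, y)"
  shows "AE z in lborel. P z"
  unfolding lborel_prod[symmetric]
proof (rule lborel_pair.AE_pair_measure)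
  have "{z \<in> space (lborel \<Otimes>\<^sub>M lborel). P z} = {z. P z}" by (simp add: space_pair_measure)
  moreover have "sets (lborel \<Otimes>\<^sub>M lborel) = sets (borel :: ('a \<times> 'b) measure)"
    unfolding lborel_prod by simp
  ultimately show "{z \<in> space (lborel \<Otimes>\<^sub>M lborel). P z} \<in> sets (lborel \<Otimes>\<^sub>M lborel)"
    using assms(1) by simp
qed (rule assms(2))

lemma AE_lborel_fst:
  assumes "AE x in lborel. P x"
  shows "AE z in (lborel :: ('a::euclidean_space \<times> 'b::euclidean_space) measure). P (fst z)"
proof -
  obtain N where N: "{x. \<not> P x} \<subseteq> N" "N \<in> sets borel" "emeasure lborel N = 0"
    using assms by (auto elim!: AE_E)
  have "emeasure (lborel :: ('a \<times> 'b) measure) (N \<times> UNIV) = 0"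
    using lborel.emeasure_pair_measure_Times[of N lborel UNIV] N by (simp add: lborel_prod)
  moreover have "N \<times> (UNIV :: 'b set) \<in> sets borel"
    using N(2) by (simp flip: borel_prod)
  ultimately have "N \<times> (UNIV :: 'b set) \<in> null_sets lborel" by (intro null_setsI) simp_all
  then show ?thesis by (rule AE_I') (use N in auto)
qed

lemma cyl_section_borel [measurable]:
  fixes E :: "(real \<times> (real^'m)) set"
  assumes "E \<in> sets borel"
  shows "cyl_section E x1 \<in> sets borel"
proof -
  have "Pair x1 -` E \<in> sets borel" using assms unfolding borel_prod[symmetric] by (rule sets_Pair1)
  then show ?thesis by (simp add: cyl_section_def vimage_def)
qed

lemma emeasure_cyl_section_measurable [measurable]:
  fixes E :: "(real \<times> (real^'m)) set"
  assumes "E \<in> sets borel"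
  shows "(\<lambda>x1. emeasure lborel (cyl_section E x1)) \<in> borel_measurable borel"
proof -
  have "(\<lambda>x1. emeasure lborel (Pair x1 -` E)) \<in> borel_measurable lborel"
    by (rule lborel.measurable_emeasure_Pair) (use assms in \<open>simp only: lborel_prod sets_lborel\<close>)
  then show ?thesis by (simp add: cyl_section_def vimage_def)
qed

lemma cyl_section_cyl_rearrangement: "cyl_section (cyl_rearrangement E) x1 = ball_rearrangement (cyl_section E x1)"
  by (simp add: cyl_section_def cyl_rearrangement_def)

lemma cyl_rearrangement_borel [measurable]:
  fixes E :: "(real \<times> (real^'m)) set"
  assumes [measurable]: "E \<in> sets borel"
  shows "cyl_rearrangement E \<in> sets borel"
proof -
  let ?f = "\<lambda>z :: real \<times> (real^'m). emeasure lborel (cyl_section E (fst z))"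
  let ?g = "\<lambda>z :: real \<times> (real^'m). ennreal (unit_ball_vol (real CARD('m)) * norm (snd z) ^ CARD('m))"
  have [measurable]: "?f \<in> borel_measurable (borel \<Otimes>\<^sub>M borel)" "?g \<in> borel_measurable (borel \<Otimes>\<^sub>M borel)"
    by measurable
  have "cyl_rearrangement E = {z \<in> space (borel \<Otimes>\<^sub>M borel). ?f z = \<infinity> \<or> ?g z < ?f z}"
    by (auto simp: cyl_rearrangement_def mem_ball_rearrangement_iff emeasure_ball space_pair_measure)
  also have "\<dots> \<in> sets (borel \<Otimes>\<^sub>M borel)" by measurable
  finally show ?thesis by (simp only: borel_prod)
qed

text \<open>Single sections of \<open>E\<close> may fail to be measurable. Almost every one agrees
  almost everywhere with a Borel section of \<open>F\<close>; by completeness of Lebesgue measure it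
  is then measurable with the same volume.\<close>

lemma cyl_rearrangement_AE_cong:
  fixes E F :: "(real \<times> (real^'m)) set"
  assumes [measurable]: "F \<in> sets borel" and AE: "AE z in lborel. z \<in> E \<longleftrightarrow> z \<in> F"
  shows "AE z in lborel. z \<in> cyl_rearrangement E \<longleftrightarrow> z \<in> cyl_rearrangement F"
proof -
  have "AE x1 in lborel. ball_rearrangement (cyl_section E x1) = ball_rearrangement (cyl_section F x1)"
    using AE_lborel_pairD[OF AE]
  proof eventually_elim
    case (elim x1)
    then have ae: "AE x' in lebesgue. x' \<in> cyl_section F x1 \<longleftrightarrow> x' \<in> cyl_section E x1"
      by (auto simp: cyl_section_def AE_completion_iff)
    have F: "cyl_section F x1 \<in> sets lebesgue" by simp
    have E: "cyl_section E x1 \<in> sets lebesgue"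
      by (rule completion.in_sets_AE[OF ae F]) simp
    have "emeasure lebesgue (cyl_section E x1) = emeasure lebesgue (cyl_section F x1)"
      by (rule emeasure_eq_AE[OF _ E F]) (use ae in auto)
    then show ?case by (simp add: ball_rearrangement_def)
  qed
  from AE_lborel_fst[OF this] show ?thesis
    by eventually_elim (auto simp: cyl_rearrangement_def)
qed

lemma periodic_perimeter_AE_cong:
  assumes AE: "AE z in lborel. z \<in> E \<longleftrightarrow> z \<in> F"
  shows "periodic_perimeter K E = periodic_perimeter K F"
proof -
  have "(\<integral>\<^sup>+ y \<in> - E. ennreal (K (x - y)) \<partial>lebesgue) = (\<integral>\<^sup>+ y \<in> - F. ennreal (K (x - y)) \<partial>lebesgue)" for x
    unfolding nn_integral_completion using AE
    by (intro nn_integral_cong_AE) (auto elim!: eventually_mono simp: indicator_def)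
  then show ?thesis
    unfolding periodic_perimeter_def nn_integral_completion using AE
    by (intro nn_integral_cong_AE) (auto elim!: eventually_mono simp: indicator_def)
qed

lemma slab_borel [measurable]: "(slab :: (real \<times> (real^'m)) set) \<in> sets borel"
proof -
  have "{z \<in> space (borel \<Otimes>\<^sub>M borel). - pi < fst z \<and> fst z < pi} \<in> sets (borel \<Otimes>\<^sub>M (borel :: (real^'m) measure))"
    by measurable
  then show ?thesis unfolding borel_prod by (simp add: slab_def)
qed

section \<open>The perimeter as an integral over pairs of slices\<close>

text \<open>\<open>K\<^sub>0\<close> is a Borel version of the kernel.\<close>

locale cylindrical_kernel =
  fixes K :: "real \<times> (real^'m) \<Rightarrow> real" and K0 :: "real \<times> (real^'m) \<Rightarrow> ennreal"
  assumes K0_borel: "K0 \<in> borel_measurable borel"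
    and K0_eq: "AE z in lborel. K0 z = ennreal (K z)"
    and sections: "s \<noteq> 0 \<Longrightarrow> radial_kernel_cart (kernel_section K s)"
begin

lemma K0_measurable [measurable]: "K0 \<in> borel_measurable (borel \<Otimes>\<^sub>M borel)"
  using K0_borel by (simp add: borel_prod)

lemma periodic_perimeter_lborel:
  assumes [measurable]: "E \<in> sets borel"
  shows "periodic_perimeter K E =
    (\<integral>\<^sup>+x. \<integral>\<^sup>+y. indicator (E \<inter> slab) x * (indicator (- E) y * K0 (x - y)) \<partial>lborel \<partial>lborel)"
proof -
  note K0_borel [measurable]
  have "(\<integral>\<^sup>+y. ennreal (K (x - y)) * indicator (- E) y \<partial>lborel) = (\<integral>\<^sup>+y. indicator (- E) y * K0 (x - y) \<partial>lborel)" for x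
    using AE_lborel_reflect[OF K0_eq, of x]
    by (intro nn_integral_cong_AE) (auto elim!: eventually_mono simp: indicator_def)
  then show ?thesis
    unfolding periodic_perimeter_def nn_integral_completion
    by (simp add: nn_integral_cmult mult.commute)
qed

text \<open>Formed with \<open>K0\<close> instead of \<open>kernel_section\<close>, because
  interchanging the integrals over slices requires a jointly Borel kernel.\<close>

definition slice_energy :: "(real \<times> (real^'m)) set \<Rightarrow> real \<Rightarrow> real \<Rightarrow> ennreal" where
  "slice_energy E x1 y1 = (\<integral>\<^sup>+x'. \<integral>\<^sup>+y'. indicator (cyl_section E x1) x' * indicator (- cyl_section E y1) y'
     * K0 (x1 - y1, x' - y') \<partial>lborel \<partial>lborel)"

lemma measurable_pair_sections [measurable]:
  assumes "E \<in> sets (borel :: (real \<times> (real^'m)) measure)"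
  shows "(\<lambda>(x1, x'). indicator (cyl_section E x1) x' :: ennreal) \<in> borel_measurable (borel \<Otimes>\<^sub>M borel)"
    and "(\<lambda>(x1, x'). indicator (- cyl_section E x1) x' :: ennreal) \<in> borel_measurable (borel \<Otimes>\<^sub>M borel)"
proof -
  have "(\<lambda>(x1, x'). indicator (cyl_section F x1) x' :: ennreal) \<in> borel_measurable (borel \<Otimes>\<^sub>M borel)"
    if "F \<in> sets borel" for F :: "(real \<times> (real^'m)) set"
  proof -
    have "(\<lambda>(x1, x'). indicator (cyl_section F x1) x' :: ennreal) = indicator F"
      by (auto simp: fun_eq_iff cyl_section_def indicator_def)
    then show ?thesis using that by (simp add: borel_prod)
  qed
  from this[OF assms] this[of "- E"]
  show "(\<lambda>(x1, x'). indicator (cyl_section E x1) x' :: ennreal) \<in> borel_measurable (borel \<Otimes>\<^sub>M borel)"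
    and "(\<lambda>(x1, x'). indicator (- cyl_section E x1) x' :: ennreal) \<in> borel_measurable (borel \<Otimes>\<^sub>M borel)"
    using assms by (auto simp: cyl_section_def Compl_eq)
qed

lemma slice_energy_measurable [measurable]:
  assumes [measurable]: "E \<in> sets borel"
  shows "(\<lambda>(x1, y1). slice_energy E x1 y1) \<in> borel_measurable (borel \<Otimes>\<^sub>M borel)"
  unfolding slice_energy_def by measurable

lemma periodic_perimeter_slices:
  assumes [measurable]: "E \<in> sets borel"
  shows "periodic_perimeter K E =
    (\<integral>\<^sup>+x1. \<integral>\<^sup>+y1. indicator {- pi<..<pi} x1 * slice_energy E x1 y1 \<partial>lborel \<partial>lborel)"
proof -
  define f where "f x1 x' y1 y' = indicator {- pi<..<pi} x1 * (indicator (cyl_section E x1) x' *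
      indicator (- cyl_section E y1) y' * K0 (x1 - y1, x' - y'))" for x1 x' y1 y'
  have f: "indicator (E \<inter> slab) (x1, x') * (indicator (- E) (y1, y') * K0 ((x1, x') - (y1, y'))) = f x1 x' y1 y'" for x1 x' y1 y'
    by (auto simp: f_def indicator_def slab_def cyl_section_def)
  note K0_borel [measurable]
  have "periodic_perimeter K E = (\<integral>\<^sup>+x. \<integral>\<^sup>+y1. \<integral>\<^sup>+y'. indicator (E \<inter> slab) x * (indicator (- E) (y1, y') * K0 (x - (y1, y'))) \<partial>lborel \<partial>lborel \<partial>lborel)"
    unfolding periodic_perimeter_lborel[OF assms]
    by (intro nn_integral_cong nn_integral_lborel_pair) measurable
  also have "\<dots> = (\<integral>\<^sup>+x1. \<integral>\<^sup>+x'. \<integral>\<^sup>+y1. \<integral>\<^sup>+y'. f x1 x' y1 y' \<partial>lborel \<partial>lborel \<partial>lborel \<partial>lborel)"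
    unfolding f[symmetric] by (intro nn_integral_lborel_pair) measurable
  also have "\<dots> = (\<integral>\<^sup>+x1. \<integral>\<^sup>+y1. \<integral>\<^sup>+x'. \<integral>\<^sup>+y'. f x1 x' y1 y' \<partial>lborel \<partial>lborel \<partial>lborel \<partial>lborel)"
    unfolding f_def by (rule nn_integral_cong, rule lborel_pair.Fubini') measurable
  also have "\<dots> = (\<integral>\<^sup>+x1. \<integral>\<^sup>+y1. indicator {- pi<..<pi} x1 * slice_energy E x1 y1 \<partial>lborel \<partial>lborel)"
    unfolding f_def slice_energy_def by (simp add: nn_integral_cmult)
  finally show ?thesis .
qed

text \<open>The height differences at which a slice energy is an interaction with an integrable
  radial kernel. Integrability is not assumed at height 0, and on a null set of heights
  \<open>K0\<close> may differ from \<open>K\<close> on a whole section.\<close>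

definition regular :: "real \<Rightarrow> bool" where
  "regular s \<longleftrightarrow> s \<noteq> 0 \<and> (AE z in lborel. K0 (s, z) = kernel_section K s z)"

lemma AE_regular: "AE y1 in lborel. regular (x1 - y1)"
proof -
  have "AE s in lborel. regular s"
    using AE_lborel_pairD[OF K0_eq] AE_lborel_singleton[of "0 :: real"]
  proof eventually_elim
    case (elim s)
    have "AE z in lborel. K0 (s, z) = kernel_section K s z"
      using elim(1) AE_lborel_singleton[of "0 :: real^'m"]
      by eventually_elim (simp add: kernel_section_def)
    with elim show ?case by (simp add: regular_def)
  qed
  then show ?thesis by (rule AE_lborel_reflect)
qed

lemma slice_energy_eq_interaction:
  assumes "regular (x1 - y1)"
  shows "slice_energy E x1 y1 =
    interaction (kernel_section K (x1 - y1)) (cyl_section E x1) (- cyl_section E y1)"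
  unfolding slice_energy_def interaction_def
proof (rule nn_integral_cong, rule nn_integral_cong_AE)
  fix x'
  have "AE z in lborel. K0 (x1 - y1, z) = kernel_section K (x1 - y1) z"
    using assms by (simp add: regular_def)
  from AE_lborel_reflect[OF this, of x']
  show "AE y' in lborel. indicator (cyl_section E x1) x' * indicator (- cyl_section E y1) y' * K0 (x1 - y1, x' - y')
      = indicator (cyl_section E x1) x' * indicator (- cyl_section E y1) y' * kernel_section K (x1 - y1) (x' - y')"
    by eventually_elim simp
qed

lemma emeasure_slab_sections:
  assumes [measurable]: "E \<in> sets borel"
  shows "emeasure lborel (E \<inter> slab) = (\<integral>\<^sup>+x1. indicator {- pi<..<pi} x1 * emeasure lborel (cyl_section E x1) \<partial>lborel)"
proof -
  have "emeasure lborel (E \<inter> slab) = (\<integral>\<^sup>+z. indicator (E \<inter> slab) z \<partial>lborel)"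
    by (rule nn_integral_indicator[symmetric]) measurable
  also have "\<dots> = (\<integral>\<^sup>+x1. \<integral>\<^sup>+x'. indicator (E \<inter> slab) (x1, x') \<partial>lborel \<partial>lborel)"
    by (rule nn_integral_lborel_pair) measurable
  also have "\<dots> = (\<integral>\<^sup>+x1. \<integral>\<^sup>+x'. indicator {- pi<..<pi} x1 * indicator (cyl_section E x1) x' \<partial>lborel \<partial>lborel)"
    by (intro nn_integral_cong) (auto simp: indicator_def slab_def cyl_section_def)
  also have "\<dots> = (\<integral>\<^sup>+x1. indicator {- pi<..<pi} x1 * emeasure lborel (cyl_section E x1) \<partial>lborel)"
    by (simp add: nn_integral_cmult)
  finally show ?thesis .
qed

lemma slice_energy_cyl_rearrangement_le:
  assumes [measurable]: "E \<in> sets borel" and "regular (x1 - y1)" "emeasure lborel (cyl_section E x1) \<noteq> \<infinity>"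
  shows "slice_energy (cyl_rearrangement E) x1 y1 \<le> slice_energy E x1 y1"
proof -
  interpret radial_kernel_cart "kernel_section K (x1 - y1)"
    using assms(2) by (intro sections) (simp add: regular_def)
  show ?thesis
    unfolding slice_energy_eq_interaction[OF assms(2)] cyl_section_cyl_rearrangement
    by (rule interaction_ball_rearrangement) (use assms in auto)
qed

lemma AE_finite_sections:
  assumes [measurable]: "E \<in> sets borel" and "emeasure lborel (E \<inter> slab) \<noteq> \<infinity>"
  shows "AE x1 in lborel. x1 \<in> {- pi<..<pi} \<longrightarrow> emeasure lborel (cyl_section E x1) \<noteq> \<infinity>"
proof -
  have "AE x1 in lborel. indicator {- pi<..<pi} x1 * emeasure lborel (cyl_section E x1) \<noteq> \<infinity>"
    by (rule nn_integral_PInf_AE) (use assms in \<open>auto simp: emeasure_slab_sections\<close>)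
  then show ?thesis by eventually_elim (auto simp: indicator_def)
qed

lemma periodic_perimeter_cyl_rearrangement_le:
  assumes [measurable]: "E \<in> sets borel" and fin: "emeasure lborel (E \<inter> slab) \<noteq> \<infinity>"
  shows "periodic_perimeter K (cyl_rearrangement E) \<le> periodic_perimeter K E"
proof -
  have "periodic_perimeter K (cyl_rearrangement E) = (\<integral>\<^sup>+x1. \<integral>\<^sup>+y1. indicator {- pi<..<pi} x1 * slice_energy (cyl_rearrangement E) x1 y1 \<partial>lborel \<partial>lborel)"
    by (rule periodic_perimeter_slices) measurable
  also have "\<dots> \<le> (\<integral>\<^sup>+x1. \<integral>\<^sup>+y1. indicator {- pi<..<pi} x1 * slice_energy E x1 y1 \<partial>lborel \<partial>lborel)"
  proof (rule nn_integral_mono_AE)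
    show "AE x1 in lborel. (\<integral>\<^sup>+y1. indicator {- pi<..<pi} x1 * slice_energy (cyl_rearrangement E) x1 y1 \<partial>lborel)
        \<le> (\<integral>\<^sup>+y1. indicator {- pi<..<pi} x1 * slice_energy E x1 y1 \<partial>lborel)"
      using AE_finite_sections[OF assms]
    proof eventually_elim
      case (elim x1)
      show ?case
      proof (rule nn_integral_mono_AE)
        show "AE y1 in lborel. indicator {- pi<..<pi} x1 * slice_energy (cyl_rearrangement E) x1 y1
            \<le> indicator {- pi<..<pi} x1 * slice_energy E x1 y1"
          using AE_regular[of x1]
          by eventually_elim (use elim in \<open>auto simp: indicator_def intro!: slice_energy_cyl_rearrangement_le\<close>)
      qed
    qed
  qed
  also have "\<dots> = periodic_perimeter K E"
    by (rule periodic_perimeter_slices[symmetric]) measurable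
  finally show ?thesis .
qed

text \<open>The slab is invariant under translations in the last variables, and the kernel depends
  only on differences. This gives the easy direction of the equality statement.\<close>

lemma periodic_perimeter_shift:
  assumes [measurable]: "E \<in> sets borel"
  shows "periodic_perimeter K {z. z - (0, c) \<in> E} = periodic_perimeter K E"
proof -
  note K0_borel [measurable]
  let ?F = "{z. z - (0, c) \<in> E}"
  have F [measurable]: "?F \<in> sets borel" by measurable
  have slab: "z + (0, c) \<in> slab \<longleftrightarrow> z \<in> slab" for z :: "real \<times> (real^'m)" by (simp add: slab_def)
  define g where "g x y = indicator (?F \<inter> slab) x * (indicator (- ?F) y * K0 (x - y))" for x y
  have [measurable]: "(\<lambda>(x, y). g x y) \<in> borel_measurable (borel \<Otimes>\<^sub>M borel)"
    unfolding g_def by measurable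
  have "periodic_perimeter K ?F = (\<integral>\<^sup>+x. \<integral>\<^sup>+y. g x y \<partial>lborel \<partial>lborel)"
    unfolding g_def by (rule periodic_perimeter_lborel[OF F])
  also have "\<dots> = (\<integral>\<^sup>+x. \<integral>\<^sup>+y. g (x + (0, c)) y \<partial>lborel \<partial>lborel)"
    by (rule nn_integral_lborel_shift[symmetric]) measurable
  also have "\<dots> = (\<integral>\<^sup>+x. \<integral>\<^sup>+y. g (x + (0, c)) (y + (0, c)) \<partial>lborel \<partial>lborel)"
    by (intro nn_integral_cong nn_integral_lborel_shift[symmetric]) measurable
  also have "\<dots> = periodic_perimeter K E"
    unfolding periodic_perimeter_lborel[OF assms] g_def
    by (intro nn_integral_cong) (simp add: indicator_def slab)
  finally show ?thesis .
qed

text \<open>A single reference slice at a height \<open>x1\<close> in the slab suffices: almost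
  every height \<open>y1\<close> on the whole line attains equality together with it, so its centre
  is passed on to all other slices.\<close>

lemma periodic_perimeter_eqD:
  assumes E [measurable]: "E \<in> sets borel"
    and slab: "emeasure lborel (E \<inter> slab) \<noteq> 0" "emeasure lborel (E \<inter> slab) \<noteq> \<infinity>"
    and fin: "periodic_perimeter K E \<noteq> \<infinity>"
    and eq: "periodic_perimeter K (cyl_rearrangement E) = periodic_perimeter K E"
  shows "\<exists>c. AE z in lborel. z \<in> E \<longleftrightarrow> z - (0, c) \<in> cyl_rearrangement E"
proof -
  let ?I = "{- pi<..<pi}" and ?S = "cyl_section E"
  define f g where "f x1 y1 = indicator ?I x1 * slice_energy (cyl_rearrangement E) x1 y1"
    and "g x1 y1 = indicator ?I x1 * slice_energy E x1 y1" for x1 y1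
  have [measurable]: "(\<lambda>(x1, y1). f x1 y1) \<in> borel_measurable (borel \<Otimes>\<^sub>M borel)"
    "(\<lambda>(x1, y1). g x1 y1) \<in> borel_measurable (borel \<Otimes>\<^sub>M borel)"
    unfolding f_def g_def by measurable
  have PE: "periodic_perimeter K E = (\<integral>\<^sup>+x1. \<integral>\<^sup>+y1. g x1 y1 \<partial>lborel \<partial>lborel)"
    unfolding g_def by (rule periodic_perimeter_slices[OF E])
  have PF: "periodic_perimeter K (cyl_rearrangement E) = (\<integral>\<^sup>+x1. \<integral>\<^sup>+y1. f x1 y1 \<partial>lborel \<partial>lborel)"
    unfolding f_def by (rule periodic_perimeter_slices) measurable
  have le: "AE x1 in lborel. AE y1 in lborel. f x1 y1 \<le> g x1 y1"
    using AE_finite_sections[OF E slab(2)]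
  proof eventually_elim
    case (elim x1)
    show ?case
      using AE_regular[of x1]
      by eventually_elim
        (use elim in \<open>auto simp: f_def g_def indicator_def intro!: slice_energy_cyl_rearrangement_le\<close>)
  qed
  then have le': "AE x1 in lborel. (\<integral>\<^sup>+y1. f x1 y1 \<partial>lborel) \<le> (\<integral>\<^sup>+y1. g x1 y1 \<partial>lborel)"
    by eventually_elim (rule nn_integral_mono_AE)
  have "AE x1 in lborel. (\<integral>\<^sup>+y1. f x1 y1 \<partial>lborel) = (\<integral>\<^sup>+y1. g x1 y1 \<partial>lborel)"
    by (rule nn_integral_eq_imp_AE_eq[OF _ _ le']) (use eq fin in \<open>auto simp: PE PF\<close>)
  moreover have "AE x1 in lborel. (\<integral>\<^sup>+y1. g x1 y1 \<partial>lborel) \<noteq> \<infinity>"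
    by (rule nn_integral_PInf_AE) (use fin in \<open>auto simp: PE\<close>)
  ultimately have AE_eq: "AE x1 in lborel. AE y1 in lborel. f x1 y1 = g x1 y1"
    using le
  proof eventually_elim
    case (elim x1)
    then show ?case by (intro nn_integral_eq_imp_AE_eq) auto
  qed
  \<comment> \<open>The heights in the slab with non-null slices. They have positive measure because
    \<open>E \<inter> slab\<close> does, so both \<open>x1\<close> and its partner \<open>y0\<close>
    can be taken from this set.\<close>
  define X where "X = {x1. x1 \<in> ?I \<and> emeasure lborel (?S x1) \<noteq> 0}"
  have [measurable]: "X \<in> sets lborel" unfolding X_def by measurable
  have X: "emeasure lborel X \<noteq> 0"
  proof
    assume "emeasure lborel X = 0"
    with \<open>X \<in> sets lborel\<close> have "AE x1 in lborel. x1 \<notin> X" by (intro AE_not_in null_setsI)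
    then have "AE x1 in lborel. indicator ?I x1 * emeasure lborel (?S x1) = 0"
      by eventually_elim (auto simp: X_def indicator_def)
    then have "emeasure lborel (E \<inter> slab) = 0"
      unfolding emeasure_slab_sections[OF E] by (subst nn_integral_0_iff_AE) auto
    with slab(1) show False by simp
  qed
  have "AE x1 in lborel. (x1 \<in> ?I \<longrightarrow> emeasure lborel (?S x1) \<noteq> \<infinity>) \<and> (AE y1 in lborel. f x1 y1 = g x1 y1)"
    using AE_finite_sections[OF E slab(2)] AE_eq by eventually_elim simp
  from AE_positive_measure_ex[OF this X] obtain x1 where "x1 \<in> X"
    and x1: "x1 \<in> ?I" "emeasure lborel (?S x1) \<noteq> 0" "emeasure lborel (?S x1) \<noteq> \<infinity>" "AE y1 in lborel. f x1 y1 = g x1 y1"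
    by (auto simp: X_def)
  define good where "good y1 \<longleftrightarrow> regular (x1 - y1) \<and> f x1 y1 = g x1 y1" for y1
  have good: "AE y1 in lborel. good y1"
    using AE_regular[of x1] x1(4) by eventually_elim (simp add: good_def)
  have int_eq: "interaction (kernel_section K (x1 - y1)) (ball_rearrangement (?S x1)) (- ball_rearrangement (?S y1))
      = interaction (kernel_section K (x1 - y1)) (?S x1) (- ?S y1)" if "good y1" for y1
    using that x1(1) slice_energy_eq_interaction[of x1 y1 E] slice_energy_eq_interaction[of x1 y1 "cyl_rearrangement E"]
    by (simp add: good_def f_def g_def cyl_section_cyl_rearrangement)
  have kernel: "radial_kernel_cart (kernel_section K (x1 - y1))" if "good y1" for y1
    using that by (intro sections) (simp add: good_def regular_def)
  have S [measurable]: "?S y1 \<in> sets borel" for y1 by measurable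
  note D = radial_kernel_cart.interaction_ball_rearrangement_eqD[OF kernel S S x1(2,3) int_eq]
  have "AE y1 in lborel. (y1 \<in> ?I \<longrightarrow> emeasure lborel (?S y1) \<noteq> \<infinity>) \<and> good y1"
    using AE_finite_sections[OF E slab(2)] good by eventually_elim simp
  \<comment> \<open>The equality case speaks about pairs of slices, so one partner \<open>y0\<close>
    is needed to see that the reference slice is a ball and to fix its centre
    \<open>c\<close>.\<close>
  from AE_positive_measure_ex[OF this X] obtain y0
    where y0: "good y0" "emeasure lborel (?S y0) \<noteq> 0" "emeasure lborel (?S y0) \<noteq> \<infinity>"
    by (auto simp: X_def)
  obtain c a where a: "a > 0" "ball_rearrangement (?S x1) = ball 0 a" "sym_diff (?S x1) (ball c a) \<in> null_sets lborel"
    using D(2)[OF y0(1) y0(1) y0(2,3)] by blast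
  have "AE y1 in lborel. AE y' in lborel. (y1, y') \<in> E \<longleftrightarrow> (y1, y') - (0, c) \<in> cyl_rearrangement E"
    using good
  proof eventually_elim
    case (elim y1)
    have mem: "(y1, y') - (0, c) \<in> cyl_rearrangement E \<longleftrightarrow> y' - c \<in> ball_rearrangement (?S y1)"
      "(y1, y') \<in> E \<longleftrightarrow> y' \<in> ?S y1" for y'
      by (auto simp: cyl_rearrangement_def cyl_section_def)
    \<comment> \<open>Infinite slices can occur outside the slab, where the volume of
      \<open>E\<close> is not controlled; they fill the whole space up to a null set. Null slices
      correspond to empty balls, and both kinds are compatible with every centre.\<close>
    consider "emeasure lborel (?S y1) = 0" | "emeasure lborel (?S y1) = \<infinity>"
      | "emeasure lborel (?S y1) \<noteq> 0" "emeasure lborel (?S y1) \<noteq> \<infinity>" by blast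
    then have "AE y' in lborel. y' \<in> ?S y1 \<longleftrightarrow> y' - c \<in> ball_rearrangement (?S y1)"
    proof cases
      case 1
      then have "AE y' in lborel. y' \<notin> ?S y1" by (intro AE_not_in) (auto simp: null_sets_def)
      then show ?thesis
        by eventually_elim (use 1 in \<open>simp add: mem_ball_rearrangement_iff\<close>)
    next
      case 2
      have "AE y' in lborel. y' \<notin> - ?S y1"
        by (rule AE_not_in, rule D(1)[OF elim elim 2])
      then show ?thesis
        by eventually_elim (use 2 in \<open>simp add: mem_ball_rearrangement_iff\<close>)
    next
      case 3
      obtain c' a' b where b: "ball_rearrangement (?S x1) = ball 0 a'" "ball_rearrangement (?S y1) = ball 0 b"
        "sym_diff (?S x1) (ball c' a') \<in> null_sets lborel" "sym_diff (?S y1) (ball c' b) \<in> null_sets lborel" "a' > 0"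
        using D(2)[OF elim elim 3] by blast
      \<comment> \<open>The pair (x1, y1) yields its own centre \<open>c'\<close>; both
        \<open>c\<close> and \<open>c'\<close> are centres of the reference slice, which identifies
        them.\<close>
      have "a' = a" using a b by (auto simp: ball_eq_ball_iff)
      with a b have "c' = c" using ball_center_unique by blast
      have "AE y' in lborel. y' \<notin> sym_diff (?S y1) (ball c b)"
        using b(4) unfolding \<open>c' = c\<close> by (rule AE_not_in)
      then show ?thesis
        unfolding b(2) by eventually_elim (auto simp: dist_norm norm_minus_commute)
    qed
    then show ?case unfolding mem .
  qed
  then have "AE z in lborel. z \<in> E \<longleftrightarrow> z - (0, c) \<in> cyl_rearrangement E"
    by (intro AE_lborel_pairI) measurable
  then show ?thesis by blast
qed

end

section \<open>From Borel to Lebesgue measurable sets and kernels\<close>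

theorem lemma1p2:
  fixes E :: "(real \<times> (real^'m)) set"
    and K :: "real \<times> (real^'m) \<Rightarrow> real"
  assumes E_meas: "E \<in> sets lebesgue"
    and E_fin: "emeasure lebesgue (E \<inter> slab) < \<infinity>"
    and K_meas: "K \<in> borel_measurable lebesgue"
    and K_pos: "\<forall>x. 0 < K x"
    and K_inv: "\<forall>x1 x' (R :: real^'m^'m). orthogonal_matrix R \<longrightarrow> K (x1, R *v x') = K (x1, x')"
    and K_decr: "\<forall>x1 x' y'. 0 < norm x' \<and> norm x' < norm y' \<longrightarrow> K (x1, y') < K (x1, x')"
    and K_int: "\<forall>x1. x1 \<noteq> 0 \<longrightarrow> integrable lebesgue (\<lambda>x'. K (x1, x'))"
  shows "periodic_perimeter K (cyl_rearrangement E) \<le> periodic_perimeter K E \<and>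
    (0 < emeasure lebesgue (E \<inter> slab) \<and> periodic_perimeter K E < \<infinity> \<longrightarrow>
      (periodic_perimeter K (cyl_rearrangement E) = periodic_perimeter K E \<longleftrightarrow>
        (\<exists>c :: real^'m.
          sym_diff E ((\<lambda>x. x + (0, c)) ` cyl_rearrangement E) \<in> null_sets lebesgue)))"
proof -
  have "(\<lambda>x. ennreal (K x)) \<in> borel_measurable lebesgue" using K_meas by measurable
  then obtain K0 where K0: "K0 \<in> borel_measurable lborel" "AE z in lborel. ennreal (K z) = K0 z"
    using completion_ex_borel_measurable[of "\<lambda>x. ennreal (K x)" lborel] by blast
  interpret cylindrical_kernel K K0
  proof (rule cylindrical_kernel.intro)
    show "K0 \<in> borel_measurable borel" using K0(1) by simp
    show "AE z in lborel. K0 z = ennreal (K z)" using K0(2) by eventually_elim simp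
    show "radial_kernel_cart (kernel_section K s)" if "s \<noteq> 0" for s
      using K_int that by (intro radial_kernel_section K_pos K_inv K_decr) auto
  qed
  \<comment> \<open>\<open>F\<close> is a Borel set that differs from \<open>E\<close> by a null
    set; perimeter, rearrangement and volume in the slab do not see the difference.\<close>
  obtain F N N' where N: "N' \<in> null_sets lborel" "N \<subseteq> N'" and F: "F \<in> sets lborel" and E_eq: "E = F \<union> N"
    using E_meas by (rule sets_completionE)
  note F' [measurable] = F[unfolded sets_lborel]
  have EF: "AE z in lborel. z \<in> E \<longleftrightarrow> z \<in> F"
    using AE_not_in[OF N(1)] by eventually_elim (use N(2) in \<open>auto simp: E_eq\<close>)
  have cEF: "AE z in lborel. z \<in> cyl_rearrangement E \<longleftrightarrow> z \<in> cyl_rearrangement F"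
    by (rule cyl_rearrangement_AE_cong[OF F' EF])
  have P: "periodic_perimeter K E = periodic_perimeter K F"
    "periodic_perimeter K (cyl_rearrangement E) = periodic_perimeter K (cyl_rearrangement F)"
    by (rule periodic_perimeter_AE_cong[OF EF], rule periodic_perimeter_AE_cong[OF cEF])
  have slab: "emeasure lebesgue (E \<inter> slab) = emeasure lborel (F \<inter> slab)"
  proof -
    have "emeasure lebesgue (E \<inter> slab) = emeasure lebesgue (F \<inter> slab)"
    proof (rule emeasure_eq_AE)
      show "AE z in lebesgue. z \<in> E \<inter> slab \<longleftrightarrow> z \<in> F \<inter> slab"
        unfolding AE_completion_iff using EF by eventually_elim auto
      have sl: "slab \<in> sets lebesgue" using slab_borel by (intro sets_completionI_sets) simp
      show "E \<inter> slab \<in> sets lebesgue" using E_meas sl by (rule sets.Int)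
      show "F \<inter> slab \<in> sets lebesgue" using sets_completionI_sets[OF F] sl by (rule sets.Int)
    qed
    also have "\<dots> = emeasure lborel (F \<inter> slab)" by simp
    finally show ?thesis .
  qed
  have fin: "emeasure lborel (F \<inter> slab) \<noteq> \<infinity>" using E_fin slab by simp
  have shift: "z \<in> (\<lambda>x. x + (0, c)) ` A \<longleftrightarrow> z - (0, c) \<in> A" for z c and A :: "(real \<times> (real^'m)) set"
    by (force simp: image_iff)
  have cEF_shift: "AE z in lborel. z - (0, c) \<in> cyl_rearrangement E \<longleftrightarrow> z - (0, c) \<in> cyl_rearrangement F" for c
    unfolding diff_conv_add_uminus by (rule AE_lborel_shift[OF cEF])
  \<comment> \<open>By completeness, being a Lebesgue null set is an almost-everywhere statement, so
    the condition on \<open>E\<close> transfers to \<open>F\<close> without a separate measurability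
    proof for the symmetric difference.\<close>
  have iff: "sym_diff E ((\<lambda>x. x + (0, c)) ` cyl_rearrangement E) \<in> null_sets lebesgue \<longleftrightarrow>
      (AE z in lborel. z \<in> F \<longleftrightarrow> z - (0, c) \<in> cyl_rearrangement F)" for c
  proof -
    have "sym_diff E ((\<lambda>x. x + (0, c)) ` cyl_rearrangement E) \<in> null_sets lebesgue \<longleftrightarrow>
      (AE z in lborel. z \<notin> sym_diff E ((\<lambda>x. x + (0, c)) ` cyl_rearrangement E))"
      by (simp only: completion.null_sets_iff_AE AE_completion_iff) simp
    also have "\<dots> \<longleftrightarrow> (AE z in lborel. z \<in> F \<longleftrightarrow> z - (0, c) \<in> cyl_rearrangement F)"
    proof (intro iffI)
      assume "AE z in lborel. z \<notin> sym_diff E ((\<lambda>x. x + (0, c)) ` cyl_rearrangement E)"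
      with EF cEF_shift[of c] show "AE z in lborel. z \<in> F \<longleftrightarrow> z - (0, c) \<in> cyl_rearrangement F"
        by eventually_elim (auto simp: shift)
    next
      assume "AE z in lborel. z \<in> F \<longleftrightarrow> z - (0, c) \<in> cyl_rearrangement F"
      with EF cEF_shift[of c] show "AE z in lborel. z \<notin> sym_diff E ((\<lambda>x. x + (0, c)) ` cyl_rearrangement E)"
        by eventually_elim (auto simp: shift)
    qed
    finally show ?thesis .
  qed
  have "periodic_perimeter K (cyl_rearrangement F) = periodic_perimeter K F"
    if "AE z in lborel. z \<in> F \<longleftrightarrow> z - (0, c) \<in> cyl_rearrangement F" for c
  proof -
    have "periodic_perimeter K F = periodic_perimeter K {z. z - (0, c) \<in> cyl_rearrangement F}"
      by (rule periodic_perimeter_AE_cong) (use that in simp)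
    also have "\<dots> = periodic_perimeter K (cyl_rearrangement F)"
      by (rule periodic_perimeter_shift) measurable
    finally show ?thesis by simp
  qed
  moreover have "\<exists>c. AE z in lborel. z \<in> F \<longleftrightarrow> z - (0, c) \<in> cyl_rearrangement F"
    if "0 < emeasure lborel (F \<inter> slab)" "periodic_perimeter K F < \<infinity>"
      "periodic_perimeter K (cyl_rearrangement F) = periodic_perimeter K F"
    using that fin by (intro periodic_perimeter_eqD[OF F']) auto
  ultimately show ?thesis
    using periodic_perimeter_cyl_rearrangement_le[OF F' fin]
    unfolding P slab iff by blast
qed

end
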